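(* Let $\mathcal U\subseteq\mathbb R^m$, $\mathcal V\subseteq\mathbb R^n$ be nonempty compact convex sets, and let $h:u\mapsto a^\top u$ be a linear function such that $h(u)\ge0$ for all $u\in\mathcal U$ and $h(u)>0$ for all $u\in\operatorname{relint}\mathcal U$. Let $\mathcal Z=\mathcal U\triangleleft^h\mathcal V=\{(u,h(u)v):u\in\mathcal U,v\in\mathcal V\}$. Let $d_u:\mathcal U\to\mathbb R$ and $d_v:\mathcal V\to\mathbb R$ be distance-generating functions for $\mathcal U$ and $\mathcal V$, strongly convex with respect to norms $\|\cdot\|_u$ and $\|\cdot\|_v$, respectively, and let $\alpha_v>0$ be a scalar. Then the function \[ d_z:\mathcal Z\ni(u,w)\mapsto d_u(u)+\alpha_v\,d_v^\square(u,w),\qquad d_v^\square(u,w)=\begin{cases}0&\text{if }h(u)=0\\ h(u)\,d_v\!\left(\dfrac{w}{h(u)}\right)&\text{if }h(u)>0\end{cases} \] is a distance-generating function for $\mathcal Z$. Furthermore, if $d_u$ and $d_v$ are ``nice'' distance-generating functions, then so is $d_z$.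
   Context: A distance-generating function (DGF) for a compact convex set $\mathcal X\subseteq\mathbb R^n$ is a function $d:\mathcal X\to\mathbb R$ that is continuous on $\mathcal X$, differentiable in $\operatorname{relint}\mathcal X$, strongly convex in $\operatorname{relint}\mathcal X$ with respect to some norm $\|\cdot\|$ (i.e. there is $\mu>0$ with $(\nabla d(x)-\nabla d(x'))^\top(x-x')\ge\mu\|x-x'\|^2$ for all $x,x'\in\operatorname{relint}\mathcal X$), and satisfies $\min_{x\in\mathcal X}d(x)=0$. The gradient of the convex conjugate is $\nabla d^*(g)=\arg\max_{x\in\mathcal X}\{g^\top x-d(x)\}$ for $g\in\mathbb R^n$. A DGF $d$ is called ``nice'' if $d(x)$, $\nabla d(x)$ (at $x\in\operatorname{relint}\mathcal X$) and $\nabla d^*(g)$ (at any $g\in\mathbb R^n$) can be computed exactly in linear time in the dimension of the domain of $d$. The set $\mathcal U\triangleleft^h\mathcal V$ is called the scaled extension of $\mathcal U$ with $\mathcal V$ via $h$; scaled extension is defined for nonempty convex sets. *)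

theory Defs
  imports "HOL-Analysis.Analysis"
begin

definition is_norm :: "('a::real_vector \<Rightarrow> real) \<Rightarrow> bool" where
  "is_norm \<nu> \<longleftrightarrow>
     (\<forall>x. 0 \<le> \<nu> x) \<and> (\<forall>x. \<nu> x = 0 \<longleftrightarrow> x = 0) \<and>
     (\<forall>c x. \<nu> (c *\<^sub>R x) = \<bar>c\<bar> * \<nu> x) \<and> (\<forall>x y. \<nu> (x + y) \<le> \<nu> x + \<nu> y)"

text \<open>
  The function \<open>d\<close> only matters on \<open>X\<close>, which need not be full-dimensional, so gradients are
  taken relative to \<open>X\<close>: \<open>g\<close> is a gradient of \<open>d\<close> at \<open>x\<close> if it represents the derivative within
  \<open>X\<close>. For \<open>x\<close> in the relative interior, \<open>g\<close> is determined up to a vector orthogonal to the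
  direction space of the affine hull of \<open>X\<close>; the inner products \<open>(g - g') \<bullet> (x - x')\<close> below
  therefore do not depend on the choice.
\<close>

definition has_grad :: "'a::euclidean_space set \<Rightarrow> ('a \<Rightarrow> real) \<Rightarrow> 'a \<Rightarrow> 'a \<Rightarrow> bool" where
  "has_grad X d x g \<longleftrightarrow> (d has_derivative (\<lambda>y. g \<bullet> y)) (at x within X)"

definition strongly_convex_relint ::
  "('a::euclidean_space \<Rightarrow> real) \<Rightarrow> 'a set \<Rightarrow> ('a \<Rightarrow> real) \<Rightarrow> bool" where
  "strongly_convex_relint \<nu> X d \<longleftrightarrow>
     (\<exists>\<mu>>0. \<forall>x\<in>rel_interior X. \<forall>x'\<in>rel_interior X. \<forall>g g'.
        has_grad X d x g \<longrightarrow> has_grad X d x' g' \<longrightarrow>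
        (g - g') \<bullet> (x - x') \<ge> \<mu> * (\<nu> (x - x'))\<^sup>2)"

definition dgf_wrt ::
  "('a::euclidean_space \<Rightarrow> real) \<Rightarrow> 'a set \<Rightarrow> ('a \<Rightarrow> real) \<Rightarrow> bool" where
  "dgf_wrt \<nu> X d \<longleftrightarrow>
     compact X \<and> convex X \<and>
     continuous_on X d \<and>
     (\<forall>x\<in>rel_interior X. d differentiable (at x within X)) \<and>
     strongly_convex_relint \<nu> X d \<and>
     (\<forall>x\<in>X. 0 \<le> d x) \<and> (\<exists>x\<in>X. d x = 0)"

definition is_dgf :: "'a::euclidean_space set \<Rightarrow> ('a \<Rightarrow> real) \<Rightarrow> bool" where
  "is_dgf X d \<longleftrightarrow> (\<exists>\<nu>. is_norm \<nu> \<and> dgf_wrt \<nu> X d)"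

text \<open>
  Branching programs over real registers with unit cost per instruction (algebraic computation
  trees). Besides constants, the four arithmetic operations and comparisons there may be further
  unary primitives, such as \<open>exp\<close>, \<open>ln\<close> or \<open>sqrt\<close>; which ones are available is a parameter
  \<open>\<Phi>\<close> of the model. Since a program is a tree, loops are unrolled, and the running time on an
  input is the number of nodes passed on the path taken.
\<close>

datatype arith = Plus | Minus | Times | Divide

datatype instr =
    Const nat real                         \<comment> \<open>target, value\<close>
  | Arith arith nat nat nat                \<comment> \<open>operation, target, operands\<close>
  | Prim "real \<Rightarrow> real" nat nat            \<comment> \<open>primitive, target, operand\<close>

datatype prog =
    Halt
  | Do instr prog
  | IfLe nat nat prog prog                 \<comment> \<open>compare two registers\<close>

type_synonym memory = "nat \<Rightarrow> real"

fun arith_op :: "arith \<Rightarrow> real \<Rightarrow> real \<Rightarrow> real" where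
  "arith_op Plus x y = x + y"
| "arith_op Minus x y = x - y"
| "arith_op Times x y = x * y"
| "arith_op Divide x y = x / y"

fun exec_instr :: "instr \<Rightarrow> memory \<Rightarrow> memory" where
  "exec_instr (Const k c) \<sigma> = \<sigma>(k := c)"
| "exec_instr (Arith f k i j) \<sigma> = \<sigma>(k := arith_op f (\<sigma> i) (\<sigma> j))"
| "exec_instr (Prim \<phi> k i) \<sigma> = \<sigma>(k := \<phi> (\<sigma> i))"

fun exec :: "prog \<Rightarrow> memory \<Rightarrow> memory" where
  "exec Halt \<sigma> = \<sigma>"
| "exec (Do c P) \<sigma> = exec P (exec_instr c \<sigma>)"
| "exec (IfLe i j P Q) \<sigma> = (if \<sigma> i \<le> \<sigma> j then exec P \<sigma> else exec Q \<sigma>)"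

fun steps :: "prog \<Rightarrow> memory \<Rightarrow> nat" where
  "steps Halt \<sigma> = 0"
| "steps (Do c P) \<sigma> = Suc (steps P (exec_instr c \<sigma>))"
| "steps (IfLe i j P Q) \<sigma> = Suc (if \<sigma> i \<le> \<sigma> j then steps P \<sigma> else steps Q \<sigma>)"

fun prims_instr :: "instr \<Rightarrow> (real \<Rightarrow> real) set" where
  "prims_instr (Prim \<phi> k i) = {\<phi>}"
| "prims_instr (Const k c) = {}"
| "prims_instr (Arith f k i j) = {}"

fun prims :: "prog \<Rightarrow> (real \<Rightarrow> real) set" where
  "prims Halt = {}"
| "prims (Do c P) = prims_instr c \<union> prims P"
| "prims (IfLe i j P Q) = prims P \<union> prims Q"

text \<open>
  A vector is stored in registers \<open>0, 1, \<dots>\<close> by its coordinates with respect to an enumeration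
  \<open>bs\<close> of the standard basis. The contents of all other registers are arbitrary.
\<close>

definition stores :: "'a::euclidean_space list \<Rightarrow> memory \<Rightarrow> 'a \<Rightarrow> bool" where
  "stores bs \<sigma> x \<longleftrightarrow> (\<forall>k<length bs. \<sigma> k = x \<bullet> (bs ! k))"

definition computable_in ::
  "(real \<Rightarrow> real) set \<Rightarrow> nat \<Rightarrow> 'a::euclidean_space list \<Rightarrow> 'b::euclidean_space list \<Rightarrow>
   'a set \<Rightarrow> ('a \<Rightarrow> 'b) \<Rightarrow> bool" where
  "computable_in \<Phi> t bs bs' S f \<longleftrightarrow>
     (\<exists>P. prims P \<subseteq> \<Phi> \<and>
        (\<forall>x\<in>S. \<forall>\<sigma>. stores bs \<sigma> x \<longrightarrow> steps P \<sigma> \<le> t \<and> stores bs' (exec P \<sigma>) (f x)))"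

text \<open>
  For a single set \<open>X\<close> of fixed dimension, ``linear time in the dimension'' has a meaning only
  through the constant of proportionality. It is therefore an explicit argument \<open>c\<close> of the
  following predicate: an asymptotic statement about a family of functions in growing dimension
  says that one and the same \<open>c\<close> works for all its members. The function \<open>A\<close> is the gradient of
  the conjugate.
\<close>

definition nice_dgf ::
  "(real \<Rightarrow> real) set \<Rightarrow> nat \<Rightarrow> 'a::euclidean_space set \<Rightarrow> ('a \<Rightarrow> real) \<Rightarrow> bool" where
  "nice_dgf \<Phi> c X d \<longleftrightarrow>
     is_dgf X d \<and>
     (\<exists>bs. distinct bs \<and> set bs = Basis \<and>
        computable_in \<Phi> (c * DIM('a)) bs [1] X d \<and>
        (\<exists>G. (\<forall>x\<in>rel_interior X. has_grad X d x (G x)) \<and>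
             computable_in \<Phi> (c * DIM('a)) bs bs (rel_interior X) G) \<and>
        (\<exists>A. (\<forall>g. is_arg_max (\<lambda>x. g \<bullet> x - d x) (\<lambda>x. x \<in> X) (A g)) \<and>
             computable_in \<Phi> (c * DIM('a)) bs bs UNIV A))"

definition scaled_extension ::
  "('a \<Rightarrow> real) \<Rightarrow> 'a set \<Rightarrow> 'b::real_vector set \<Rightarrow> ('a \<times> 'b) set" where
  "scaled_extension h U V = {(u, h u *\<^sub>R v) | u v. u \<in> U \<and> v \<in> V}"

definition dilation ::
  "('a \<Rightarrow> real) \<Rightarrow> ('b::real_vector \<Rightarrow> real) \<Rightarrow> 'a \<times> 'b \<Rightarrow> real" where
  "dilation h d = (\<lambda>(u, w). if h u = 0 then 0 else h u * d (w /\<^sub>R h u))"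

end

theory Submission
  imports Defs
begin

text \<open>
  Write a point of \<open>Z\<close> as \<open>(u, h v)\<close> with \<open>h = h(u)\<close>. The Bregman divergence of the dilation from
  \<open>(u, h v)\<close> to \<open>(u', h' v')\<close> is \<open>h'\<close> times that of \<open>d\<^sub>v\<close> from \<open>v\<close> to \<open>v'\<close>, so the monotonicity
  gap of its gradient is at least a multiple of \<open>(h + h') |v - v'|\<^sup>2\<close>. As \<open>V\<close> is bounded and \<open>h\<close> is
  Lipschitz, \<open>|h v - h' v'|\<^sup>2\<close> is bounded by this quantity plus a multiple of \<open>|u - u'|\<^sup>2\<close>, which the
  strong convexity of \<open>d\<^sub>u\<close> absorbs.

  The gradient at \<open>(u, h v)\<close> is \<open>(\<nabla>d\<^sub>u(u) + \<alpha> (d\<^sub>v(v) - \<nabla>d\<^sub>v(v) \<bullet> v) a, \<alpha> \<nabla>d\<^sub>v(v))\<close>, and the maximizer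
  for \<open>(g\<^sub>u, g\<^sub>v)\<close> is obtained by first maximizing over \<open>v\<close> for \<open>g\<^sub>v / \<alpha>\<close> and then over \<open>u\<close> for
  \<open>g\<^sub>u\<close> shifted by a multiple of \<open>a\<close>. Hence a bounded number of calls to the given programs and of
  vector operations suffices.
\<close>

section \<open>Gradients within a convex set\<close>

lemma is_norm_norm: "is_norm (norm :: 'a::real_normed_vector \<Rightarrow> real)"
  by (simp add: is_norm_def norm_triangle_ineq)

text \<open>A norm is convex, hence continuous, and attains a positive minimum on the compact unit
  sphere; homogeneity carries this bound to all vectors. It reduces strong convexity in any norm to
  the Euclidean case.\<close>

lemma is_norm_ge_norm:
  fixes \<nu> :: "'a::euclidean_space \<Rightarrow> real"
  assumes "is_norm \<nu>"
  obtains c where "c > 0" "\<And>x. c * norm x \<le> \<nu> x"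
proof -
  have pos: "0 \<le> \<nu> x" and zero: "\<nu> x = 0 \<longleftrightarrow> x = 0"
    and scale: "\<nu> (r *\<^sub>R x) = \<bar>r\<bar> * \<nu> x" and tri: "\<nu> (x + y) \<le> \<nu> x + \<nu> y" for r x y
    using assms by (auto simp: is_norm_def)
  have "convex_on UNIV \<nu>"
  proof (rule convex_onI)
    fix t :: real and x y assume "0 < t" "t < 1"
    then show "\<nu> ((1 - t) *\<^sub>R x + t *\<^sub>R y) \<le> (1 - t) * \<nu> x + t * \<nu> y"
      using tri[of "(1 - t) *\<^sub>R x" "t *\<^sub>R y"] by (simp add: scale)
  qed simp
  then have "continuous_on (sphere 0 1) \<nu>"
    by (meson convex_on_continuous continuous_on_subset open_UNIV subset_UNIV)
  moreover have "sphere (0::'a) 1 \<noteq> {}" by simp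
  ultimately obtain z where z: "z \<in> sphere 0 1" "\<And>x. x \<in> sphere 0 1 \<Longrightarrow> \<nu> z \<le> \<nu> x"
    using continuous_attains_inf[of "sphere (0::'a) 1" \<nu>] by auto
  show ?thesis
  proof
    show "\<nu> z > 0"
      using z(1) pos[of z] zero[of z] by (auto simp: less_le)
    show "\<nu> z * norm x \<le> \<nu> x" for x
    proof (cases "x = 0")
      case False
      then have "\<nu> z \<le> \<nu> (inverse (norm x) *\<^sub>R x)" by (intro z(2)) simp
      then show ?thesis using False by (simp add: scale field_simps)
    qed (simp add: pos)
  qed
qed

section \<open>Gradients along segments\<close>

lemma differentiable_has_grad:
  assumes "d differentiable (at x within X)"
  obtains g where "has_grad X d x g"
proof -
  obtain f where f: "(d has_derivative f) (at x within X)"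
    using assms by (auto simp: differentiable_def)
  then have "linear f" by (rule has_derivative_linear)
  \<comment> \<open>Riesz representation: the adjoint of a real-valued linear map sends 1 to the
    representing vector.\<close>
  then have "f = (\<bullet>) (adjoint f 1)"
    using adjoint_works[of f _ 1] by (simp add: inner_commute fun_eq_iff)
  then show thesis using f that[of "adjoint f 1"] by (simp add: has_grad_def)
qed

text \<open>Chain rule along a segment. The derivative is taken within \<open>{0..1}\<close> because
  only this part of the line is known to lie in \<open>X\<close>.\<close>

lemma has_grad_line:
  assumes "convex X" "x \<in> X" "y \<in> X" "t \<in> {0..1}" "has_grad X d (x + t *\<^sub>R (y - x)) g"
  shows "((\<lambda>s. d (x + s *\<^sub>R (y - x))) has_real_derivative g \<bullet> (y - x)) (at t within {0..1})"
proof -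
  let ?l = "\<lambda>s. x + s *\<^sub>R (y - x)"
  have sub: "?l ` {0..1} \<subseteq> X"
  proof clarify
    fix s :: real assume "s \<in> {0..1}"
    then have "(1 - s) *\<^sub>R x + s *\<^sub>R y \<in> X"
      using assms by (intro convexD) auto
    then show "?l s \<in> X" by (simp add: algebra_simps)
  qed
  have "(?l has_derivative (\<lambda>s. s *\<^sub>R (y - x))) (at t within {0..1})"
    by (auto intro!: derivative_eq_intros)
  moreover have "(d has_derivative (\<bullet>) g) (at (?l t) within ?l ` {0..1})"
    using assms(5) has_derivative_subset[OF _ sub] by (simp add: has_grad_def)
  ultimately have "((\<lambda>s. d (?l s)) has_derivative (\<lambda>s. g \<bullet> (s *\<^sub>R (y - x)))) (at t within {0..1})"
    by (rule has_derivative_in_compose)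
  moreover have "(\<lambda>s. g \<bullet> (s *\<^sub>R (y - x))) = (*) (g \<bullet> (y - x))"
    by (simp add: fun_eq_iff)
  ultimately show ?thesis by (simp only: has_field_derivative_def)
qed

text \<open>Both products equal the one-sided derivative of \<open>d\<close> at \<open>x\<close>
  towards \<open>y\<close>, which is unique even where the gradient is not. Hence an arbitrary
  gradient can later be exchanged for an explicit one.\<close>

lemma has_grad_inner_unique:
  assumes "convex X" "x \<in> X" "y \<in> X" "has_grad X d x g" "has_grad X d x g'"
  shows "g \<bullet> (y - x) = g' \<bullet> (y - x)"
proof -
  have "((\<lambda>s. d (x + s *\<^sub>R (y - x))) has_vector_derivative g \<bullet> (y - x)) (at 0 within cbox 0 1)"
    "((\<lambda>s. d (x + s *\<^sub>R (y - x))) has_vector_derivative g' \<bullet> (y - x)) (at 0 within cbox 0 1)"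
    using has_grad_line[OF assms(1-3), of 0 d] assms
    by (auto simp flip: has_real_derivative_iff_has_vector_derivative)
  then show ?thesis
    by (intro vector_derivative_unique_within_closed_interval[of 0 1 0]) auto
qed

section \<open>Strong monotonicity and Bregman divergences\<close>

definition strongly_monotone_grad :: "real \<Rightarrow> 'a::euclidean_space set \<Rightarrow> ('a \<Rightarrow> real) \<Rightarrow> bool" where
  "strongly_monotone_grad \<mu> X d \<longleftrightarrow>
     (\<forall>x\<in>rel_interior X. \<forall>x'\<in>rel_interior X. \<forall>g g'.
        has_grad X d x g \<longrightarrow> has_grad X d x' g' \<longrightarrow>
        \<mu> * (norm (x - x'))\<^sup>2 \<le> (g - g') \<bullet> (x - x'))"

text \<open>A lower bound \<open>c\<close> of the given norm against the Euclidean one enters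
  squared, so the modulus drops to \<open>\<mu> * c\<^sup>2\<close>.\<close>

lemma dgf_wrt_strongly_monotone_grad:
  assumes "is_norm \<nu>" "dgf_wrt \<nu> X d"
  obtains \<mu> where "\<mu> > 0" "strongly_monotone_grad \<mu> X d"
proof -
  obtain c where c: "c > 0" "\<And>x. c * norm x \<le> \<nu> x"
    using is_norm_ge_norm[OF assms(1)] by blast
  obtain \<mu> where "\<mu> > 0" and \<mu>: "\<And>x x' g g'. x \<in> rel_interior X \<Longrightarrow> x' \<in> rel_interior X \<Longrightarrow>
      has_grad X d x g \<Longrightarrow> has_grad X d x' g' \<Longrightarrow> \<mu> * (\<nu> (x - x'))\<^sup>2 \<le> (g - g') \<bullet> (x - x')"
    using assms(2) unfolding dgf_wrt_def strongly_convex_relint_def by blast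
  have "\<mu> * c\<^sup>2 * (norm (x - x'))\<^sup>2 \<le> \<mu> * (\<nu> (x - x'))\<^sup>2" for x x'
    using power_mono[OF c(2)[of "x - x'"], of 2] c(1) \<open>\<mu> > 0\<close>
    by (simp add: power_mult_distrib)
  then have "strongly_monotone_grad (\<mu> * c\<^sup>2) X d"
    unfolding strongly_monotone_grad_def using \<mu> by (meson order_trans)
  then show thesis using that[of "\<mu> * c\<^sup>2"] \<open>\<mu> > 0\<close> c(1) by simp
qed

text \<open>Restrict \<open>d\<close> to the segment and subtract both the tangent and the quadratic
  term. The resulting \<open>?\<phi>\<close> has a nonnegative derivative inside the interval by
  strong monotonicity, so the mean value theorem gives
  \<open>?\<phi> 0 \<le> ?\<phi> 1\<close>.\<close>

lemma Bregman_lower_bound: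
  assumes "convex X" and diff: "\<forall>x\<in>rel_interior X. d differentiable (at x within X)"
    and mono: "strongly_monotone_grad \<mu> X d"
    and x: "x \<in> rel_interior X" and y: "y \<in> rel_interior X" and g: "has_grad X d x g"
  shows "\<mu> / 2 * (norm (y - x))\<^sup>2 \<le> d y - d x - g \<bullet> (y - x)"
proof -
  let ?l = "\<lambda>s. x + s *\<^sub>R (y - x)"
  let ?\<phi> = "\<lambda>s. d (?l s) - s * (g \<bullet> (y - x)) - \<mu> / 2 * s\<^sup>2 * (norm (y - x))\<^sup>2"
  have l: "?l s \<in> rel_interior X" if "0 \<le> s" "s \<le> 1" for s
  proof -
    have "(1 - s) *\<^sub>R x + s *\<^sub>R y \<in> rel_interior X"
      using that x y convex_rel_interior[OF \<open>convex X\<close>] by (intro convexD) auto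
    then show ?thesis by (simp add: algebra_simps)
  qed
  have XX: "x \<in> X" "y \<in> X" using x y rel_interior_subset by blast+
  have "\<exists>g. has_grad X d (?l s) g" if "0 \<le> s" "s \<le> 1" for s
    using diff l[OF that] by (blast elim: differentiable_has_grad)
  then obtain G where G: "\<And>s. 0 \<le> s \<Longrightarrow> s \<le> 1 \<Longrightarrow> has_grad X d (?l s) (G s)" by metis
  let ?D = "\<lambda>s. (G s - g) \<bullet> (y - x) - \<mu> * s * (norm (y - x))\<^sup>2"
  have "(?\<phi> has_derivative (\<lambda>r. ?D s * r)) (at s within {0..1})" if "0 \<le> s" "s \<le> 1" for s
    using has_grad_line[OF \<open>convex X\<close> XX _ G[OF that]] that
    unfolding has_field_derivative_def[symmetric]
    by (auto intro!: derivative_eq_intros simp: inner_diff_left)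
  from mvt_simple[OF _ this] obtain s where s: "0 < s" "s < 1" "?\<phi> 1 - ?\<phi> 0 = ?D s"
    by auto
  \<comment> \<open>As \<open>?l s - x\<close> is \<open>s\<close> times \<open>y - x\<close>, both
    sides carry a factor \<open>s > 0\<close>, which cancels and leaves
    \<open>0 \<le> ?D s\<close>.\<close>
  have "\<mu> * (norm (?l s - x))\<^sup>2 \<le> (G s - g) \<bullet> (?l s - x)"
    using mono l[of s] x G[of s] g s(1,2) unfolding strongly_monotone_grad_def
    by (meson less_imp_le)
  then have "s * (\<mu> * s * (norm (y - x))\<^sup>2) \<le> s * ((G s - g) \<bullet> (y - x))"
    by (simp add: power_mult_distrib power2_eq_square mult_ac)
  then have "0 \<le> ?D s" using s by simp
  then show ?thesis using s(3) by simp
qed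

section \<open>Dilations\<close>

text \<open>A symmetric splitting: one part is the mean scaling times \<open>v - v'\<close>, the
  other is half of \<open>h - h'\<close> times \<open>v + v'\<close>. Bounding only one of the two
  factors \<open>h + h'\<close> by \<open>2 * H\<close> keeps the weight \<open>h + h'\<close> with
  which the Bregman divergences of the dilation can absorb the first term.\<close>

lemma norm_scaled_diff_bound:
  fixes v v' :: "'a::real_inner" and h h' H M :: real
  assumes "0 \<le> h" "0 \<le> h'" "h \<le> H" "h' \<le> H" "norm v \<le> M" "norm v' \<le> M"
  shows "(norm (h *\<^sub>R v - h' *\<^sub>R v'))\<^sup>2 \<le> H * (h + h') * (norm (v - v'))\<^sup>2 + 2 * M\<^sup>2 * (h - h')\<^sup>2"
proof -
  let ?p = "((h + h') / 2) *\<^sub>R (v - v')" and ?q = "((h - h') / 2) *\<^sub>R (v + v')"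
  have eq: "h *\<^sub>R v - h' *\<^sub>R v' = ?p + ?q"
  proof -
    have "?p + ?q = ((h + h') / 2 + (h - h') / 2) *\<^sub>R v - ((h + h') / 2 - (h - h') / 2) *\<^sub>R v'"
      by (simp only: scaleR_add_left scaleR_diff_left scaleR_add_right scaleR_diff_right) simp
    then show ?thesis by (simp add: field_simps)
  qed
  \<comment> \<open>This is the nonnegativity of the squared norm of \<open>p - q\<close>,
    expanded.\<close>
  have "(norm (p + q))\<^sup>2 \<le> 2 * (norm p)\<^sup>2 + 2 * (norm q)\<^sup>2" for p q :: 'a
    using inner_ge_zero[of "p - q"]
    by (simp add: power2_norm_eq_inner inner_add_left inner_add_right inner_diff_left
        inner_diff_right inner_commute del: inner_ge_zero)
  from this[of ?p ?q] have "(norm (?p + ?q))\<^sup>2 \<le> 2 * (norm ?p)\<^sup>2 + 2 * (norm ?q)\<^sup>2" .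
  moreover have "2 * (norm ?p)\<^sup>2 \<le> H * (h + h') * (norm (v - v'))\<^sup>2"
  proof -
    have "2 * (norm ?p)\<^sup>2 = ((h + h') * (h + h') / 2) * (norm (v - v'))\<^sup>2"
      by (simp add: power_mult_distrib power2_eq_square)
    also have "\<dots> \<le> H * (h + h') * (norm (v - v'))\<^sup>2"
      using assms mult_right_mono[of "(h + h') / 2" H "h + h'"] by (intro mult_right_mono) auto
    finally show ?thesis .
  qed
  moreover have "2 * (norm ?q)\<^sup>2 \<le> 2 * M\<^sup>2 * (h - h')\<^sup>2"
  proof -
    have "norm (v + v') \<le> 2 * M" using norm_triangle_ineq[of v v'] assms by linarith
    then have "(norm (v + v'))\<^sup>2 \<le> (2 * M)\<^sup>2" by (intro power_mono) auto
    then have "(h - h')\<^sup>2 / 2 * (norm (v + v'))\<^sup>2 \<le> (h - h')\<^sup>2 / 2 * (2 * M)\<^sup>2"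
      by (intro mult_left_mono) auto
    then show ?thesis by (simp add: power_mult_distrib power_divide mult_ac)
  qed
  ultimately show ?thesis unfolding eq by linarith
qed

section \<open>The setting and the geometry of the scaled extension\<close>

locale scaled_dgf =
  fixes U :: "'a::euclidean_space set" and V :: "'b::euclidean_space set"
    and a :: 'a and d\<^sub>u \<nu>\<^sub>u :: "'a \<Rightarrow> real" and d\<^sub>v \<nu>\<^sub>v :: "'b \<Rightarrow> real" and \<alpha> :: real
  assumes h_nonneg: "u \<in> U \<Longrightarrow> 0 \<le> a \<bullet> u"
    and h_pos: "u \<in> rel_interior U \<Longrightarrow> 0 < a \<bullet> u"
    and norm_u: "is_norm \<nu>\<^sub>u" and dgf_u: "dgf_wrt \<nu>\<^sub>u U d\<^sub>u"
    and norm_v: "is_norm \<nu>\<^sub>v" and dgf_v: "dgf_wrt \<nu>\<^sub>v V d\<^sub>v"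
    and \<alpha>_pos: "0 < \<alpha>"
begin

definition Z :: "('a \<times> 'b) set" where
  "Z = scaled_extension (\<lambda>u. a \<bullet> u) U V"

definition d\<^sub>z :: "'a \<times> 'b \<Rightarrow> real" where
  "d\<^sub>z = (\<lambda>(u, w). d\<^sub>u u + \<alpha> * dilation (\<lambda>u. a \<bullet> u) d\<^sub>v (u, w))"

lemma compact_U: "compact U" and convex_U: "convex U"
  and compact_V: "compact V" and convex_V: "convex V"
  and cont_u: "continuous_on U d\<^sub>u" and cont_v: "continuous_on V d\<^sub>v"
  and diff_u: "\<forall>x\<in>rel_interior U. d\<^sub>u differentiable (at x within U)"
  and diff_v: "\<forall>x\<in>rel_interior V. d\<^sub>v differentiable (at x within V)"
  and d\<^sub>u_nonneg: "u \<in> U \<Longrightarrow> 0 \<le> d\<^sub>u u" and d\<^sub>v_nonneg: "v \<in> V \<Longrightarrow> 0 \<le> d\<^sub>v v"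
  and V_nonempty: "V \<noteq> {}"
  using dgf_u dgf_v by (auto simp: dgf_wrt_def)

lemma Z_iff: "(u, w) \<in> Z \<longleftrightarrow> u \<in> U \<and> (\<exists>v\<in>V. w = (a \<bullet> u) *\<^sub>R v)"
  by (auto simp: Z_def scaled_extension_def)

lemma Z_memI: "u \<in> U \<Longrightarrow> v \<in> V \<Longrightarrow> (u, (a \<bullet> u) *\<^sub>R v) \<in> Z"
  by (auto simp: Z_iff)

lemma Z_memE:
  assumes "z \<in> Z"
  obtains u v where "z = (u, (a \<bullet> u) *\<^sub>R v)" "u \<in> U" "v \<in> V"
  using assms by (cases z) (auto simp: Z_iff)

text \<open>In the parameters \<open>u\<close> and \<open>v\<close> the dilation is a plain product;
  where \<open>a \<bullet> u = 0\<close>, the product vanishes in agreement with the convention in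
  \<open>dilation\<close>. Most later computations use this form.\<close>

lemma d\<^sub>z_scaled: "d\<^sub>z (u, (a \<bullet> u) *\<^sub>R v) = d\<^sub>u u + \<alpha> * ((a \<bullet> u) * d\<^sub>v v)"
  by (simp add: d\<^sub>z_def dilation_def)

lemma Z_scaled: "(u, w) \<in> Z \<Longrightarrow> a \<bullet> u \<noteq> 0 \<Longrightarrow> w /\<^sub>R (a \<bullet> u) \<in> V"
  by (auto simp: Z_iff)

lemma compact_Z: "compact Z"
proof -
  have "Z = (\<lambda>(u, v). (u, (a \<bullet> u) *\<^sub>R v)) ` (U \<times> V)"
    by (auto simp: Z_def scaled_extension_def)
  moreover have "continuous_on (U \<times> V) (\<lambda>(u, v). (u, (a \<bullet> u) *\<^sub>R v))"
    unfolding case_prod_beta by (intro continuous_intros)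
  ultimately show ?thesis
    using compact_continuous_image[OF _ compact_Times[OF compact_U compact_V]] by simp
qed

text \<open>The combined second component is \<open>?p *\<^sub>R v + ?q *\<^sub>R v'\<close>, and by
  linearity the new scaling is \<open>?p + ?q\<close>. Normalizing these weights to sum 1 yields the
  required point of \<open>V\<close>.\<close>

lemma convex_Z: "convex Z"
proof (rule convexI)
  fix z z' and s t :: real assume z: "z \<in> Z" "z' \<in> Z" and st: "0 \<le> s" "0 \<le> t" "s + t = 1"
  obtain u v where z1: "z = (u, (a \<bullet> u) *\<^sub>R v)" "u \<in> U" "v \<in> V" using z(1) by (rule Z_memE)
  obtain u' v' where z2: "z' = (u', (a \<bullet> u') *\<^sub>R v')" "u' \<in> U" "v' \<in> V" using z(2) by (rule Z_memE)
  let ?p = "s * (a \<bullet> u)" and ?q = "t * (a \<bullet> u')"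
  have U: "s *\<^sub>R u + t *\<^sub>R u' \<in> U" using convex_U z1 z2 st by (intro convexD) auto
  have pq: "0 \<le> ?p" "0 \<le> ?q" using h_nonneg z1 z2 st by auto
  have h: "a \<bullet> (s *\<^sub>R u + t *\<^sub>R u') = ?p + ?q" by (simp add: inner_add_right)
  have "\<exists>v''\<in>V. ?p *\<^sub>R v + ?q *\<^sub>R v' = (?p + ?q) *\<^sub>R v''"
  proof (cases "?p + ?q = 0")
    case True
    \<comment> \<open>Both weights are nonnegative, so they vanish together and any point of
      \<open>V\<close> represents the zero vector.\<close>
    then have "?p = 0" "?q = 0" using pq by linarith+
    then have "?p *\<^sub>R v + ?q *\<^sub>R v' = (?p + ?q) *\<^sub>R v" by (simp only: scaleR_zero_left add_0)
    then show ?thesis using z1(3) by blast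
  next
    case False
    let ?v = "(?p / (?p + ?q)) *\<^sub>R v + (?q / (?p + ?q)) *\<^sub>R v'"
    have "?v \<in> V" using convex_V z1 z2 pq False
      by (intro convexD) (auto simp: add_divide_distrib[symmetric])
    moreover have "?p *\<^sub>R v + ?q *\<^sub>R v' = (?p + ?q) *\<^sub>R ?v"
      using False by (simp add: scaleR_add_right del: distrib_right)
    ultimately show ?thesis by blast
  qed
  then show "s *\<^sub>R z + t *\<^sub>R z' \<in> Z"
    using U by (simp add: z1 z2 Z_iff h)
qed

text \<open>For \<open>u\<close>, relative interiors commute with the linear projection
  \<open>fst\<close>. For \<open>v\<close>, stay in the fibre over \<open>u\<close>: a segment from
  a point over \<open>rel_interior V\<close> to \<open>z\<close> can be prolonged beyond
  \<open>z\<close> inside \<open>Z\<close>, which places \<open>v\<close> strictly between a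
  relative interior point and a point of \<open>V\<close>.\<close>

lemma rel_interior_ZE:
  assumes "z \<in> rel_interior Z"
  obtains u v where "z = (u, (a \<bullet> u) *\<^sub>R v)" "u \<in> rel_interior U" "v \<in> rel_interior V" "0 < a \<bullet> u"
proof -
  obtain u v where z: "z = (u, (a \<bullet> u) *\<^sub>R v)" "u \<in> U" "v \<in> V"
    using assms rel_interior_subset Z_memE by blast
  have "fst ` Z = U"
    using V_nonempty by (force simp: Z_def scaled_extension_def)
  then have u: "u \<in> rel_interior U"
    using rel_interior_convex_linear_image[OF linear_fst convex_Z] assms z(1) by force
  obtain v0 where v0: "v0 \<in> rel_interior V"
    using rel_interior_eq_empty[OF convex_V] V_nonempty by blast
  then have "(u, (a \<bullet> u) *\<^sub>R v0) \<in> Z"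
    using z(2) rel_interior_subset by (blast intro: Z_memI)
  then obtain e where e: "e > 1" "(1 - e) *\<^sub>R (u, (a \<bullet> u) *\<^sub>R v0) + e *\<^sub>R z \<in> Z"
    using convex_rel_interior_if2[OF convex_Z assms] hull_inc by metis
  have "(1 - e) *\<^sub>R u + e *\<^sub>R u = u" by (simp add: algebra_simps)
  with e(2) have "(u, (1 - e) *\<^sub>R (a \<bullet> u) *\<^sub>R v0 + e *\<^sub>R (a \<bullet> u) *\<^sub>R v) \<in> Z" by (simp add: z(1))
  moreover have h: "a \<bullet> u > 0" by (rule h_pos) fact
  ultimately have "((1 - e) *\<^sub>R (a \<bullet> u) *\<^sub>R v0 + e *\<^sub>R (a \<bullet> u) *\<^sub>R v) /\<^sub>R (a \<bullet> u) \<in> V"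
    using Z_scaled by (metis less_irrefl)
  moreover have "((1 - e) *\<^sub>R (a \<bullet> u) *\<^sub>R v0 + e *\<^sub>R (a \<bullet> u) *\<^sub>R v) /\<^sub>R (a \<bullet> u) = (1 - e) *\<^sub>R v0 + e *\<^sub>R v"
    using h by (simp add: scaleR_add_right field_simps)
  ultimately have y: "(1 - e) *\<^sub>R v0 + e *\<^sub>R v \<in> V" (is "?y \<in> V") by simp
  \<comment> \<open>Since \<open>?y - v0\<close> is \<open>e\<close> times \<open>v - v0\<close>,
    contracting \<open>?y\<close> towards \<open>v0\<close> by the factor \<open>1 / e < 1\<close>
    returns \<open>v\<close>.\<close>
  have "?y - (1 - 1 / e) *\<^sub>R (?y - v0) \<in> rel_interior V"
    using e(1) by (intro rel_interior_convex_shrink[OF convex_V v0 y]) auto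
  moreover have "?y - (1 - 1 / e) *\<^sub>R (?y - v0) = v"
  proof -
    have "?y - v0 = e *\<^sub>R (v - v0)" by (simp add: algebra_simps)
    moreover have "(1 - 1 / e) * e = e - 1"
      using e(1) by (simp add: field_simps)
    ultimately show ?thesis by (simp add: algebra_simps)
  qed
  ultimately show thesis using that z(1) u h by simp
qed

section \<open>Continuity and gradient of \<open>d\<^sub>z\<close>\<close>

lemma continuous_d\<^sub>z: "continuous_on Z d\<^sub>z"
proof -
  obtain B where B: "\<And>v. v \<in> V \<Longrightarrow> \<bar>d\<^sub>v v\<bar> \<le> B"
    using compact_imp_bounded[OF compact_continuous_image[OF cont_v compact_V]]
    by (auto simp: bounded_iff)
  let ?f = "dilation (\<lambda>u. a \<bullet> u) d\<^sub>v"
  have "continuous (at z within Z) ?f" if "z \<in> Z" for z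
  proof (cases "a \<bullet> fst z = 0")
    case True
    \<comment> \<open>Where the scaling vanishes, continuity follows by squeezing:
      \<open>d\<^sub>v\<close> is bounded on \<open>V\<close>, so the dilation is at most a multiple
      of the scaling.\<close>
    have le: "norm (?f y) \<le> (a \<bullet> fst y) * B" if "y \<in> Z" for y
      using that B h_nonneg by (cases y) (auto simp: dilation_def Z_iff abs_mult mult_left_mono)
    have "((\<lambda>y. (a \<bullet> fst y) * B) \<longlongrightarrow> (a \<bullet> fst z) * B) (at z within Z)"
      by (intro tendsto_intros)
    then have lim: "((\<lambda>y. (a \<bullet> fst y) * B) \<longlongrightarrow> 0) (at z within Z)"
      by (simp add: True)
    have "(?f \<longlongrightarrow> 0) (at z within Z)"
      by (rule Lim_null_comparison[OF _ lim]) (auto simp: eventually_at_filter intro!: always_eventually le[simplified])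
    then show ?thesis using True by (simp add: continuous_within dilation_def case_prod_beta)
  next
    case False
    \<comment> \<open>Continuity at \<open>z\<close> is local, and within this open set the quotient
      stays in \<open>V\<close>, where \<open>d\<^sub>v\<close> is continuous.\<close>
    let ?W = "{y. 0 < a \<bullet> fst y}"
    have "open ?W" by (intro open_Collect_less continuous_intros)
    moreover have "z \<in> ?W"
      using False that h_nonneg[of "fst z"] by (cases z) (simp add: Z_iff less_le)
    ultimately have W: "open ?W" "z \<in> ?W" .
    have "continuous_on (Z \<inter> ?W) (\<lambda>y. (a \<bullet> fst y) * d\<^sub>v (snd y /\<^sub>R (a \<bullet> fst y)))"
    proof (intro continuous_intros continuous_on_compose2[OF cont_v])
      show "(\<lambda>y. snd y /\<^sub>R (a \<bullet> fst y)) ` (Z \<inter> ?W) \<subseteq> V"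
        using Z_scaled by auto
    qed auto
    then have "continuous_on (Z \<inter> ?W) ?f"
      by (rule continuous_on_eq) (auto simp: dilation_def)
    then have "continuous (at z within (Z \<inter> ?W)) ?f"
      using that W by (simp add: continuous_on_eq_continuous_within)
    then show ?thesis using at_within_nhd[OF W(2,1), of Z "Z \<inter> ?W"] by (simp add: continuous_within)
  qed
  then have "continuous_on Z ?f" by (simp add: continuous_on_eq_continuous_within)
  moreover have "continuous_on Z (\<lambda>z. d\<^sub>u (fst z))"
    by (intro continuous_on_compose2[OF cont_u] continuous_intros) (auto simp: Z_iff)
  ultimately show ?thesis
    unfolding d\<^sub>z_def case_prod_beta by (intro continuous_intros) (simp_all add: case_prod_beta')
qed

text \<open>Quotient and product rule for \<open>h d\<^sub>v(w / h)\<close>. The derivative of the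
  quotient contributes \<open>- g\<^sub>v \<bullet> v\<close> along \<open>a\<close>, which joins
  \<open>d\<^sub>v v\<close> from differentiating the outer factor.\<close>

lemma has_grad_d\<^sub>z:
  assumes "u \<in> U" "v \<in> V" "0 < a \<bullet> u" "has_grad U d\<^sub>u u g\<^sub>u" "has_grad V d\<^sub>v v g\<^sub>v"
  shows "has_grad Z d\<^sub>z (u, (a \<bullet> u) *\<^sub>R v)
    (g\<^sub>u + (\<alpha> * (d\<^sub>v v - g\<^sub>v \<bullet> v)) *\<^sub>R a, \<alpha> *\<^sub>R g\<^sub>v)"
proof -
  let ?z = "(u, (a \<bullet> u) *\<^sub>R v)" and ?W = "{y::'a \<times> 'b. 0 < a \<bullet> fst y}"
  let ?q = "\<lambda>y::'a \<times> 'b. snd y /\<^sub>R (a \<bullet> fst y)"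
  let ?D = "\<lambda>y. g\<^sub>u \<bullet> fst y + \<alpha> * ((a \<bullet> fst y) * d\<^sub>v v + (a \<bullet> u) * (g\<^sub>v \<bullet> ((snd y - (a \<bullet> fst y) *\<^sub>R v) /\<^sub>R (a \<bullet> u))))"
  \<comment> \<open>Restricting to \<open>?W\<close> keeps \<open>?q\<close> inside
    \<open>V\<close>, where \<open>d\<^sub>v\<close> has its derivative; as an open neighbourhood of
    \<open>?z\<close> it leaves the derivative within \<open>Z\<close> unchanged.\<close>
  have W: "open ?W" "?z \<in> ?W"
    using assms by (auto intro!: open_Collect_less continuous_intros)
  have q: "(?q has_derivative (\<lambda>y. (snd y - (a \<bullet> fst y) *\<^sub>R v) /\<^sub>R (a \<bullet> u))) (at ?z within Z \<inter> ?W)"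
    using assms(3)
    by (auto intro!: derivative_eq_intros simp: algebra_simps)
  have "(d\<^sub>v has_derivative (\<bullet>) g\<^sub>v) (at (?q ?z) within ?q ` (Z \<inter> ?W))"
    using assms(3,5) Z_scaled
    by (auto simp: has_grad_def intro!: has_derivative_subset[where t = "?q ` (Z \<inter> ?W)"])
  from has_derivative_in_compose[OF q this]
  have v: "((\<lambda>y. d\<^sub>v (?q y)) has_derivative
      (\<lambda>y. g\<^sub>v \<bullet> ((snd y - (a \<bullet> fst y) *\<^sub>R v) /\<^sub>R (a \<bullet> u)))) (at ?z within Z \<inter> ?W)" .
  have "(d\<^sub>u has_derivative (\<bullet>) g\<^sub>u) (at (fst ?z) within fst ` (Z \<inter> ?W))"
    using assms(4) by (auto simp: has_grad_def Z_iff intro!: has_derivative_subset[where t = "fst ` (Z \<inter> ?W)"])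
  from has_derivative_in_compose[OF has_derivative_fst[OF has_derivative_ident] this]
  have u: "((\<lambda>y. d\<^sub>u (fst y)) has_derivative (\<lambda>y. g\<^sub>u \<bullet> fst y)) (at ?z within Z \<inter> ?W)" .
  have "((\<lambda>y. d\<^sub>u (fst y) + \<alpha> * ((a \<bullet> fst y) * d\<^sub>v (?q y))) has_derivative ?D) (at ?z within Z \<inter> ?W)"
    using assms(3) by (auto intro!: derivative_eq_intros u v)
  then have "(d\<^sub>z has_derivative ?D) (at ?z within Z \<inter> ?W)"
    by (rule has_derivative_transform[rotated 2])
       (use W assms in \<open>auto simp: d\<^sub>z_def dilation_def Z_memI\<close>)
  moreover have "?D = (\<bullet>) (g\<^sub>u + (\<alpha> * (d\<^sub>v v - g\<^sub>v \<bullet> v)) *\<^sub>R a, \<alpha> *\<^sub>R g\<^sub>v)"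
    using assms(3)
    by (simp add: inner_prod_def inner_add_left inner_diff_right fun_eq_iff) (simp add: field_simps)
  ultimately show ?thesis
    using at_within_nhd[OF W(2,1), of Z "Z \<inter> ?W"] by (simp add: has_grad_def)
qed

section \<open>Strong monotonicity of the gradient of \<open>d\<^sub>z\<close>\<close>

lemma strongly_monotone_grad_d\<^sub>z: "\<exists>\<mu>>0. strongly_monotone_grad \<mu> Z d\<^sub>z"
proof -
  obtain \<mu>\<^sub>u where \<mu>\<^sub>u: "\<mu>\<^sub>u > 0" "strongly_monotone_grad \<mu>\<^sub>u U d\<^sub>u"
    using dgf_wrt_strongly_monotone_grad[OF norm_u dgf_u] by blast
  obtain \<mu>\<^sub>v where \<mu>\<^sub>v: "\<mu>\<^sub>v > 0" "strongly_monotone_grad \<mu>\<^sub>v V d\<^sub>v"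
    using dgf_wrt_strongly_monotone_grad[OF norm_v dgf_v] by blast
  obtain B where B: "B > 0" "\<And>u. u \<in> U \<Longrightarrow> norm u \<le> B"
    using compact_imp_bounded[OF compact_U] bounded_pos by blast
  obtain M where M: "M > 0" "\<And>v. v \<in> V \<Longrightarrow> norm v \<le> M"
    using compact_imp_bounded[OF compact_V] bounded_pos by blast
  \<comment> \<open>\<open>H\<close> bounds the scaling on \<open>U\<close> by Cauchy-Schwarz; the
    summand 1 here and in \<open>K + 1\<close> makes both denominators below positive.\<close>
  define H where "H = norm a * B + 1"
  define K where "K = 2 * M\<^sup>2 * (norm a)\<^sup>2"
  \<comment> \<open>With \<open>\<theta>\<close> as weight, the bound on \<open>W\<close> costs at
    most the whole \<open>V\<close> term of the lower estimate and half of
    \<open>\<mu>\<^sub>u * X\<close>. The other half of \<open>\<mu>\<^sub>u * X\<close> pays for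
    \<open>\<mu> * X\<close>.\<close>
  define \<theta> where "\<theta> = min (\<alpha> * \<mu>\<^sub>v / 2 / H) (\<mu>\<^sub>u / 2 / (K + 1))"
  define \<mu> where "\<mu> = min \<theta> (\<mu>\<^sub>u / 2)"
  have H: "H > 0" using B(1) by (simp add: H_def add_nonneg_pos)
  have h_le: "a \<bullet> u \<le> H" if "u \<in> U" for u
    using norm_cauchy_schwarz[of a u] mult_left_mono[OF B(2)[OF that] norm_ge_zero[of a]]
    by (simp add: H_def)
  have K: "K \<ge> 0" by (simp add: K_def)
  have "\<theta> > 0" using \<mu>\<^sub>u(1) \<mu>\<^sub>v(1) \<alpha>_pos H K by (simp add: \<theta>_def)
  then have "\<mu> > 0" using \<mu>\<^sub>u(1) by (simp add: \<mu>_def)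
  have "\<theta> \<le> \<alpha> * \<mu>\<^sub>v / 2 / H" "\<theta> \<le> \<mu>\<^sub>u / 2 / (K + 1)" by (simp_all add: \<theta>_def)
  then have \<theta>: "\<theta> * H \<le> \<alpha> * \<mu>\<^sub>v / 2" "\<theta> * (K + 1) \<le> \<mu>\<^sub>u / 2"
    using H K by (simp_all add: field_simps)
  have "\<mu> * (norm (z - z'))\<^sup>2 \<le> (g - g') \<bullet> (z - z')"
    if z: "z \<in> rel_interior Z" and z': "z' \<in> rel_interior Z"
      and g: "has_grad Z d\<^sub>z z g" and g': "has_grad Z d\<^sub>z z' g'" for z z' g g'
  proof -
    obtain u v where z1: "z = (u, (a \<bullet> u) *\<^sub>R v)" "u \<in> rel_interior U" "v \<in> rel_interior V" "0 < a \<bullet> u"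
      using rel_interior_ZE[OF z] by metis
    obtain u' v' where z2: "z' = (u', (a \<bullet> u') *\<^sub>R v')" "u' \<in> rel_interior U" "v' \<in> rel_interior V" "0 < a \<bullet> u'"
      using rel_interior_ZE[OF z'] by metis
    have mem: "u \<in> U" "v \<in> V" "u' \<in> U" "v' \<in> V" "z \<in> Z" "z' \<in> Z"
      using z1 z2 z z' rel_interior_subset by blast+
    obtain p where p: "has_grad U d\<^sub>u u p" using diff_u z1 differentiable_has_grad by metis
    obtain p' where p': "has_grad U d\<^sub>u u' p'" using diff_u z2 differentiable_has_grad by metis
    obtain q where q: "has_grad V d\<^sub>v v q" using diff_v z1 differentiable_has_grad by metis
    obtain q' where q': "has_grad V d\<^sub>v v' q'" using diff_v z2 differentiable_has_grad by metis
    define h where "h = a \<bullet> u"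
    define h' where "h' = a \<bullet> u'"
    define X where "X = (norm (u - u'))\<^sup>2"
    define Y where "Y = (norm (v - v'))\<^sup>2"
    define W where "W = (norm (h *\<^sub>R v - h' *\<^sub>R v'))\<^sup>2"
    define D where "D = d\<^sub>v v' - d\<^sub>v v - q \<bullet> (v' - v)"
    define D' where "D' = d\<^sub>v v - d\<^sub>v v' - q' \<bullet> (v - v')"
    have hh: "h > 0" "h' > 0" using z1 z2 by (auto simp: h_def h'_def)
    \<comment> \<open>Only the direction \<open>z' - z\<close> matters, so the given gradient may be
      replaced by the explicit one.\<close>
    have "g \<bullet> (z' - z) = (p + (\<alpha> * (d\<^sub>v v - q \<bullet> v)) *\<^sub>R a, \<alpha> *\<^sub>R q) \<bullet> (z' - z)"
      using has_grad_inner_unique[OF convex_Z mem(5,6) g] has_grad_d\<^sub>z[OF mem(1,2) z1(4) p q] z1(1)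
      by metis
    then have G: "g \<bullet> (z' - z) = p \<bullet> (u' - u) + \<alpha> * (d\<^sub>v v - q \<bullet> v) * (h' - h) + \<alpha> * (q \<bullet> (h' *\<^sub>R v' - h *\<^sub>R v))"
      by (simp add: z1(1) z2(1) h_def h'_def inner_add_left inner_diff_right) (simp add: algebra_simps)
    have "g' \<bullet> (z - z') = (p' + (\<alpha> * (d\<^sub>v v' - q' \<bullet> v')) *\<^sub>R a, \<alpha> *\<^sub>R q') \<bullet> (z - z')"
      using has_grad_inner_unique[OF convex_Z mem(6,5) g'] has_grad_d\<^sub>z[OF mem(3,4) z2(4) p' q'] z2(1)
      by metis
    then have G': "g' \<bullet> (z - z') = p' \<bullet> (u - u') + \<alpha> * (d\<^sub>v v' - q' \<bullet> v') * (h - h') + \<alpha> * (q' \<bullet> (h *\<^sub>R v - h' *\<^sub>R v'))"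
      by (simp add: z1(1) z2(1) h_def h'_def inner_add_left inner_diff_right) (simp add: algebra_simps)
    have "(g - g') \<bullet> (z - z') = - (g \<bullet> (z' - z)) - g' \<bullet> (z - z')"
      by (simp add: inner_diff_left inner_diff_right)
    \<comment> \<open>The terms along \<open>a\<close> combine with the change of \<open>w\<close>
      so that each divergence is weighted by the scaling at its target: \<open>h'\<close> for
      \<open>D\<close> and \<open>h\<close> for \<open>D'\<close>.\<close>
    also have "\<dots> = (p - p') \<bullet> (u - u') + \<alpha> * (h' * D + h * D')"
      unfolding G G' D_def D'_def by (simp add: inner_diff_left inner_diff_right algebra_simps)
    finally have eq: "(g - g') \<bullet> (z - z') = (p - p') \<bullet> (u - u') + \<alpha> * (h' * D + h * D')" .
    have "\<mu>\<^sub>u * X \<le> (p - p') \<bullet> (u - u')"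
      using \<mu>\<^sub>u(2) z1(2) z2(2) p p' unfolding strongly_monotone_grad_def X_def by blast
    moreover have "\<mu>\<^sub>v / 2 * Y \<le> D" "\<mu>\<^sub>v / 2 * Y \<le> D'"
      using Bregman_lower_bound[OF convex_V diff_v \<mu>\<^sub>v(2) z1(3) z2(3) q]
        Bregman_lower_bound[OF convex_V diff_v \<mu>\<^sub>v(2) z2(3) z1(3) q']
      by (simp_all add: D_def D'_def Y_def norm_minus_commute)
    then have "h' * (\<mu>\<^sub>v / 2 * Y) + h * (\<mu>\<^sub>v / 2 * Y) \<le> h' * D + h * D'"
      using hh by (intro add_mono mult_left_mono) auto
    then have "\<alpha> * (h' * (\<mu>\<^sub>v / 2 * Y) + h * (\<mu>\<^sub>v / 2 * Y)) \<le> \<alpha> * (h' * D + h * D')"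
      using \<alpha>_pos by (intro mult_left_mono) auto
    then have "\<alpha> * \<mu>\<^sub>v / 2 * ((h + h') * Y) \<le> \<alpha> * (h' * D + h * D')"
      by (simp add: algebra_simps add_divide_distrib)
    ultimately have lower: "\<mu>\<^sub>u * X + \<alpha> * \<mu>\<^sub>v / 2 * ((h + h') * Y) \<le> (g - g') \<bullet> (z - z')"
      unfolding eq by linarith
    have "W \<le> H * (h + h') * Y + 2 * M\<^sup>2 * (h - h')\<^sup>2"
      unfolding W_def Y_def using hh h_le M(2) mem
      by (intro norm_scaled_diff_bound) (auto simp: h_def h'_def)
    also have "(h - h')\<^sup>2 \<le> (norm a)\<^sup>2 * X"
    proof -
      have "\<bar>h - h'\<bar> \<le> norm a * norm (u - u')"
        using Cauchy_Schwarz_ineq2[of a "u - u'"] by (simp add: h_def h'_def inner_diff_right)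
      then show ?thesis using power_mono[of "\<bar>h - h'\<bar>" "norm a * norm (u - u')" 2]
        by (simp add: X_def power_mult_distrib)
    qed
    then have "H * (h + h') * Y + 2 * M\<^sup>2 * (h - h')\<^sup>2 \<le> H * (h + h') * Y + K * X"
      using mult_left_mono[of "(h - h')\<^sup>2" "(norm a)\<^sup>2 * X" "2 * M\<^sup>2"] by (simp add: K_def mult.assoc)
    finally have W: "W \<le> H * (h + h') * Y + K * X" .
    have XY: "0 \<le> X" "0 \<le> (h + h') * Y" "0 \<le> W" using hh by (auto simp: X_def Y_def W_def)
    have "(norm (z - z'))\<^sup>2 = X + W"
      by (simp add: z1(1) z2(1) norm_prod_def X_def W_def h_def h'_def)
    then have "\<mu> * (norm (z - z'))\<^sup>2 = \<mu> * X + \<mu> * W" by (simp add: distrib_left)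
    also have "\<dots> \<le> \<mu>\<^sub>u / 2 * X + \<theta> * W"
      using XY by (intro add_mono mult_right_mono) (auto simp: \<mu>_def)
    also have "\<theta> * W \<le> \<theta> * (H * (h + h') * Y + K * X)"
      using W \<open>\<theta> > 0\<close> by (intro mult_left_mono) auto
    also have "\<dots> = \<theta> * H * ((h + h') * Y) + \<theta> * K * X" by (simp add: algebra_simps)
    also have "\<dots> \<le> \<alpha> * \<mu>\<^sub>v / 2 * ((h + h') * Y) + \<mu>\<^sub>u / 2 * X"
      using XY \<theta> \<open>\<theta> > 0\<close> by (intro add_mono mult_right_mono) (auto simp: distrib_left)
    finally show ?thesis using lower by (simp add: field_simps)
  qed
  then show ?thesis
    using \<open>\<mu> > 0\<close> unfolding strongly_monotone_grad_def by blast
qed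

lemma d\<^sub>z_differentiable:
  assumes "z \<in> rel_interior Z"
  shows "d\<^sub>z differentiable (at z within Z)"
proof -
  obtain u v where z: "z = (u, (a \<bullet> u) *\<^sub>R v)" "u \<in> rel_interior U" "v \<in> rel_interior V" "0 < a \<bullet> u"
    using rel_interior_ZE[OF assms] by metis
  obtain p where p: "has_grad U d\<^sub>u u p" using diff_u z differentiable_has_grad by metis
  obtain q where q: "has_grad V d\<^sub>v v q" using diff_v z differentiable_has_grad by metis
  have "u \<in> U" "v \<in> V" using z rel_interior_subset by blast+
  from has_grad_d\<^sub>z[OF this z(4) p q] show ?thesis
    unfolding z(1) has_grad_def differentiable_def by blast
qed

text \<open>The Euclidean norm of the product space witnesses strong convexity, and zeros of
  \<open>d\<^sub>u\<close> and \<open>d\<^sub>v\<close> combine to a zero of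
  \<open>d\<^sub>z\<close>.\<close>

theorem is_dgf_d\<^sub>z: "is_dgf Z d\<^sub>z"
proof -
  obtain \<mu> where \<mu>: "\<mu> > 0" "strongly_monotone_grad \<mu> Z d\<^sub>z"
    using strongly_monotone_grad_d\<^sub>z by blast
  then have "strongly_convex_relint norm Z d\<^sub>z"
    unfolding strongly_convex_relint_def strongly_monotone_grad_def by blast
  moreover have "0 \<le> d\<^sub>z z" if z: "z \<in> Z" for z
  proof -
    obtain u v where "z = (u, (a \<bullet> u) *\<^sub>R v)" "u \<in> U" "v \<in> V" using z by (rule Z_memE)
    then show ?thesis
      using d\<^sub>u_nonneg d\<^sub>v_nonneg h_nonneg \<alpha>_pos by (simp add: d\<^sub>z_scaled)
  qed
  moreover obtain u v where "u \<in> U" "d\<^sub>u u = 0" "v \<in> V" "d\<^sub>v v = 0"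
    using dgf_u dgf_v unfolding dgf_wrt_def by blast
  then have "(u, (a \<bullet> u) *\<^sub>R v) \<in> Z" "d\<^sub>z (u, (a \<bullet> u) *\<^sub>R v) = 0"
    by (auto simp: Z_memI d\<^sub>z_scaled)
  ultimately have "dgf_wrt norm Z d\<^sub>z"
    unfolding dgf_wrt_def
    using compact_Z convex_Z continuous_d\<^sub>z d\<^sub>z_differentiable by blast
  then show ?thesis using is_norm_norm unfolding is_dgf_def by blast
qed

end

section \<open>Vector programs\<close>

fun seq :: "prog \<Rightarrow> prog \<Rightarrow> prog" where
  "seq Halt Q = Q"
| "seq (Do c P) Q = Do c (seq P Q)"
| "seq (IfLe i j P P') Q = IfLe i j (seq P Q) (seq P' Q)"

lemma exec_seq [simp]: "exec (seq P Q) \<sigma> = exec Q (exec P \<sigma>)"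
  by (induction P arbitrary: \<sigma>) auto

text \<open>Composition puts a copy of \<open>Q\<close> at every leaf of \<open>P\<close>, but only
  one copy lies on the path taken, so running times add.\<close>

lemma steps_seq [simp]: "steps (seq P Q) \<sigma> = steps P \<sigma> + steps Q (exec P \<sigma>)"
  by (induction P arbitrary: \<sigma>) auto

text \<open>Every tree has a \<open>Halt\<close> leaf, so \<open>Q\<close> does occur in the
  composition. The inclusion form lets the simplifier split goals on primitives.\<close>

lemma prims_seq_subset: "prims (seq P Q) \<subseteq> \<Phi> \<longleftrightarrow> prims P \<subseteq> \<Phi> \<and> prims Q \<subseteq> \<Phi>"
  by (induction P) auto

fun map_instr :: "(nat \<Rightarrow> nat) \<Rightarrow> instr \<Rightarrow> instr" where
  "map_instr \<rho> (Const k c) = Const (\<rho> k) c"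
| "map_instr \<rho> (Arith f k i j) = Arith f (\<rho> k) (\<rho> i) (\<rho> j)"
| "map_instr \<rho> (Prim \<phi> k i) = Prim \<phi> (\<rho> k) (\<rho> i)"

fun relocate :: "(nat \<Rightarrow> nat) \<Rightarrow> prog \<Rightarrow> prog" where
  "relocate \<rho> Halt = Halt"
| "relocate \<rho> (Do c P) = Do (map_instr \<rho> c) (relocate \<rho> P)"
| "relocate \<rho> (IfLe i j P Q) = IfLe (\<rho> i) (\<rho> j) (relocate \<rho> P) (relocate \<rho> Q)"

lemma prims_relocate [simp]: "prims (relocate \<rho> P) = prims P"
proof (induction P)
  case (Do c P)
  then show ?case by (cases c) auto
qed auto

lemma exec_map_instr:
  assumes "inj \<rho>"
  shows "exec_instr (map_instr \<rho> c) \<sigma> \<circ> \<rho> = exec_instr c (\<sigma> \<circ> \<rho>)"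
  using assms by (cases c) (auto simp: fun_eq_iff inj_eq)

text \<open>Seen through \<open>\<rho>\<close>, the relocated program is the original one;
  injectivity guarantees that a write changes no other register of the image.\<close>

lemma exec_relocate:
  assumes "inj \<rho>"
  shows "exec (relocate \<rho> P) \<sigma> (\<rho> k) = exec P (\<lambda>k. \<sigma> (\<rho> k)) k"
proof -
  have "exec (relocate \<rho> P) \<sigma> \<circ> \<rho> = exec P (\<sigma> \<circ> \<rho>)"
    by (induction P arbitrary: \<sigma>) (auto simp: exec_map_instr[OF assms])
  then show ?thesis by (simp add: fun_eq_iff comp_def)
qed

lemma exec_relocate_frame:
  assumes "r \<notin> range \<rho>"
  shows "exec (relocate \<rho> P) \<sigma> r = \<sigma> r"
proof (induction P arbitrary: \<sigma>)
  case (Do c P)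
  then show ?case using assms by (cases c) auto
qed auto

lemma steps_relocate:
  assumes "inj \<rho>"
  shows "steps (relocate \<rho> P) \<sigma> = steps P (\<lambda>k. \<sigma> (\<rho> k))"
proof -
  have "steps (relocate \<rho> P) \<sigma> = steps P (\<sigma> \<circ> \<rho>)"
    by (induction P arbitrary: \<sigma>) (auto simp: exec_map_instr[OF assms])
  then show ?thesis by (simp add: comp_def)
qed

text \<open>Registers below \<open>N\<close> hold the input; those above are split into infinitely many infinite
  arrays, so that subprograms can be run on copies of their input without interfering.\<close>

definition arr :: "nat \<Rightarrow> nat \<Rightarrow> nat \<Rightarrow> nat" where
  "arr N j k = N + prod_encode (j, k)"

lemma arr_eq_iff [simp]: "arr N j k = arr N j' k' \<longleftrightarrow> j = j' \<and> k = k'"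
  by (simp add: arr_def)

lemma arr_neq [simp]: "k < N \<Longrightarrow> arr N j k' \<noteq> k" "k < N \<Longrightarrow> k \<noteq> arr N j k'"
  by (auto simp: arr_def)

lemma le_arr [simp]: "N \<le> arr N j k"
  by (simp add: arr_def)

lemma not_arr_less [simp]: "\<not> arr N j k < N"
  by (simp add: arr_def)

lemma inj_arr [simp]: "inj (arr N j)"
  by (simp add: inj_def)

lemma exec_relocate_arr [simp]:
  "exec (relocate (arr N j) P) \<sigma> (arr N j' k) =
     (if j' = j then exec P (\<lambda>k. \<sigma> (arr N j k)) k else \<sigma> (arr N j' k))"
  using exec_relocate[OF inj_arr, of N j P \<sigma> k] exec_relocate_frame[of "arr N j' k" "arr N j" P \<sigma>]
  by (cases "j' = j") (auto simp: image_iff)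

lemma exec_relocate_arr_input [simp]:
  "r < N \<Longrightarrow> exec (relocate (arr N j) P) \<sigma> r = \<sigma> r"
  by (rule exec_relocate_frame) auto

lemma steps_relocate_arr [simp]:
  "steps (relocate (arr N j) P) \<sigma> = steps P (\<lambda>k. \<sigma> (arr N j k))"
  by (simp add: steps_relocate)

section \<open>Vector operations and inner products\<close>

fun vconst :: "(nat \<Rightarrow> nat) \<Rightarrow> (nat \<Rightarrow> real) \<Rightarrow> nat \<Rightarrow> prog" where
  "vconst dst c 0 = Halt"
| "vconst dst c (Suc n) = seq (vconst dst c n) (Do (Const (dst n) (c n)) Halt)"

text \<open>A constant function as operand acts as a scalar, and a constant destination accumulates.
  Instructions run in order of increasing index.\<close>

fun varith :: "arith \<Rightarrow> (nat \<Rightarrow> nat) \<Rightarrow> (nat \<Rightarrow> nat) \<Rightarrow> (nat \<Rightarrow> nat) \<Rightarrow> nat \<Rightarrow> prog" where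
  "varith f dst s s' 0 = Halt"
| "varith f dst s s' (Suc n) = seq (varith f dst s s' n) (Do (Arith f (dst n) (s n) (s' n)) Halt)"

lemma prims_vconst [simp]: "prims (vconst dst c n) \<subseteq> \<Phi>"
  by (induction n) (auto simp: prims_seq_subset)

lemma steps_vconst [simp]: "steps (vconst dst c n) \<sigma> = n"
  by (induction n) auto

lemma exec_vconst:
  "inj_on dst {..<n} \<Longrightarrow> k < n \<Longrightarrow> exec (vconst dst c n) \<sigma> (dst k) = c k"
  by (induction n) (auto simp: less_Suc_eq lessThan_Suc, metis imageI lessThan_iff)

lemma exec_vconst_frame:
  "r \<notin> dst ` {..<n} \<Longrightarrow> exec (vconst dst c n) \<sigma> r = \<sigma> r"
  by (induction n) (auto simp: lessThan_Suc)

lemma prims_varith [simp]: "prims (varith f dst s s' n) \<subseteq> \<Phi>"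
  by (induction n) (auto simp: prims_seq_subset)

lemma steps_varith [simp]: "steps (varith f dst s s' n) \<sigma> = n"
  by (induction n) auto

lemma exec_varith_frame:
  "r \<notin> dst ` {..<n} \<Longrightarrow> exec (varith f dst s s' n) \<sigma> r = \<sigma> r"
  by (induction n) (auto simp: lessThan_Suc)

text \<open>A destination may only be read again by the operation that overwrites it.\<close>

lemma exec_varith:
  assumes "inj_on dst {..<n}" "k < n"
    and "\<And>i j. j < i \<Longrightarrow> i < n \<Longrightarrow> s i \<noteq> dst j \<and> s' i \<noteq> dst j"
  shows "exec (varith f dst s s' n) \<sigma> (dst k) = arith_op f (\<sigma> (s k)) (\<sigma> (s' k))"
  using assms
proof (induction n)
  case (Suc n)
  have "s n \<notin> dst ` {..<n}" "s' n \<notin> dst ` {..<n}" using Suc.prems(3) by fastforce+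
  then show ?case
    using Suc by (auto simp: less_Suc_eq lessThan_Suc exec_varith_frame) (metis imageI lessThan_iff)+
qed simp

lemma exec_vconst_arr [simp]:
  "exec (vconst (arr N j) c n) \<sigma> (arr N j' k) = (if j' = j \<and> k < n then c k else \<sigma> (arr N j' k))"
  using exec_vconst[of "arr N j" n k c \<sigma>]
  by (auto simp: inj_on_def intro!: exec_vconst_frame)

lemma exec_vconst_arr_input [simp]:
  "r < N \<Longrightarrow> exec (vconst (arr N j) c n) \<sigma> r = \<sigma> r"
  by (rule exec_vconst_frame) auto

lemma exec_varith_arr:
  assumes "\<And>i k. i < n \<Longrightarrow> s i \<noteq> arr N j k" "\<And>i k. i < n \<Longrightarrow> s' i \<noteq> arr N j k"
  shows "exec (varith f (arr N j) s s' n) \<sigma> (arr N j' k) =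
    (if j' = j \<and> k < n then arith_op f (\<sigma> (s k)) (\<sigma> (s' k)) else \<sigma> (arr N j' k))"
proof (cases "j' = j \<and> k < n")
  case True
  then show ?thesis using exec_varith[of "arr N j" n k s s' f \<sigma>] assms by (auto simp: inj_on_def)
qed (auto intro!: exec_varith_frame)

lemma exec_varith_arr_input [simp]:
  "r < N \<Longrightarrow> exec (varith f (arr N j) s s' n) \<sigma> r = \<sigma> r"
  by (rule exec_varith_frame) auto

text \<open>Serves to write results back into an input block that starts at \<open>m\<close>. A
  component may use the register it overwrites, which is read before the write.\<close>

lemma exec_varith_input:
  assumes "m + n \<le> N" "\<And>i. i < n \<Longrightarrow> s i = m + i \<or> N \<le> s i" "\<And>i. i < n \<Longrightarrow> N \<le> s' i" "r < N"
  shows "exec (varith f (\<lambda>k. m + k) s s' n) \<sigma> r =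
    (if m \<le> r \<and> r < m + n then arith_op f (\<sigma> (s (r - m))) (\<sigma> (s' (r - m))) else \<sigma> r)"
proof (cases "m \<le> r \<and> r < m + n")
  case True
  have "s i \<noteq> m + j \<and> s' i \<noteq> m + j" if "j < i" "i < n" for i j
    using assms(1) assms(2)[of i] assms(3)[of i] that by linarith
  then show ?thesis
    using True exec_varith[of "\<lambda>k. m + k" n "r - m" s s' f \<sigma>] by (auto simp: inj_on_def)
qed (auto intro!: exec_varith_frame)

lemma exec_varith_input_arr [simp]:
  "m + n \<le> N \<Longrightarrow> exec (varith f (\<lambda>k. m + k) s s' n) \<sigma> (arr N j k) = \<sigma> (arr N j k)"
  by (auto intro!: exec_varith_frame simp: arr_def)

text \<open>The block at \<open>m = 0\<close> in its own form, because
  \<open>\<lambda>k. 0 + k\<close> appears as \<open>\<lambda>k. k\<close> in programs.\<close>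

lemma exec_varith_input0:
  assumes "n \<le> N" "\<And>i. i < n \<Longrightarrow> s i = i \<or> N \<le> s i" "\<And>i. i < n \<Longrightarrow> N \<le> s' i" "r < N"
  shows "exec (varith f (\<lambda>k. k) s s' n) \<sigma> r =
    (if r < n then arith_op f (\<sigma> (s r)) (\<sigma> (s' r)) else \<sigma> r)"
  using exec_varith_input[of 0 n N s s' r f \<sigma>] assms by simp

lemma exec_varith_input0_arr [simp]:
  "n \<le> N \<Longrightarrow> exec (varith f (\<lambda>k. k) s s' n) \<sigma> (arr N j k) = \<sigma> (arr N j k)"
  using exec_varith_input_arr[of 0 n N f s s' \<sigma> j k] by simp

text \<open>The first \<open>n\<close> entries of array \<open>j\<close> take the products, and
  entry \<open>n\<close> takes their sum, starting from 0.\<close>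

definition vdot :: "nat \<Rightarrow> nat \<Rightarrow> (nat \<Rightarrow> nat) \<Rightarrow> (nat \<Rightarrow> nat) \<Rightarrow> nat \<Rightarrow> prog" where
  "vdot N j s s' n = seq (varith Times (arr N j) s s' n)
     (Do (Const (arr N j n) 0) (varith Plus (\<lambda>_. arr N j n) (\<lambda>_. arr N j n) (arr N j) n))"

lemma prims_vdot [simp]: "prims (vdot N j s s' n) \<subseteq> \<Phi>"
  by (auto simp: vdot_def prims_seq_subset)

lemma steps_vdot [simp]: "steps (vdot N j s s' n) \<sigma> = 2 * n + 1"
  by (simp add: vdot_def)

lemma exec_vsum:
  "r \<notin> s ` {..<n} \<Longrightarrow> exec (varith Plus (\<lambda>_. r) (\<lambda>_. r) s n) \<sigma> =
     \<sigma>(r := \<sigma> r + (\<Sum>k<n. \<sigma> (s k)))"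
  by (induction n) (auto simp: lessThan_Suc fun_eq_iff)

lemma exec_vdot_input [simp]: "r < N \<Longrightarrow> exec (vdot N j s s' n) \<sigma> r = \<sigma> r"
  by (auto simp: vdot_def exec_vsum image_iff)

lemma exec_vdot_frame [simp]: "j' \<noteq> j \<Longrightarrow> exec (vdot N j s s' n) \<sigma> (arr N j' k) = \<sigma> (arr N j' k)"
  by (auto simp: vdot_def exec_vsum image_iff exec_varith_frame)

lemma exec_vdot:
  assumes "\<And>i k. i < n \<Longrightarrow> s i \<noteq> arr N j k" "\<And>i k. i < n \<Longrightarrow> s' i \<noteq> arr N j k"
  shows "exec (vdot N j s s' n) \<sigma> (arr N j n) = (\<Sum>k<n. \<sigma> (s k) * \<sigma> (s' k))"
  using exec_varith_arr[OF assms] by (auto simp: vdot_def exec_vsum image_iff)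

section \<open>Programs for the scaled extension\<close>

lemma inner_basis_list:
  fixes x y :: "'a::euclidean_space"
  assumes "distinct bs" "set bs = Basis"
  shows "(\<Sum>k<length bs. (x \<bullet> (bs ! k)) * (y \<bullet> (bs ! k))) = x \<bullet> y"
  unfolding euclidean_inner[of x y] using bij_betw_nth[OF assms(1) refl assms(2)[symmetric]]
  by (rule sum.reindex_bij_betw)

text \<open>With this order the first component occupies the registers from 0 on and the second
  those from \<open>length bs\<close> on.\<close>

definition prod_basis :: "'a::euclidean_space list \<Rightarrow> 'b::euclidean_space list \<Rightarrow> ('a \<times> 'b) list" where
  "prod_basis bs bs' = map (\<lambda>b. (b, 0)) bs @ map (Pair 0) bs'"

lemma distinct_prod_basis:
  assumes "distinct bs" "set bs = Basis" "distinct bs'"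
  shows "distinct (prod_basis bs bs')"
  using assms nonzero_Basis by (auto simp: prod_basis_def distinct_map inj_on_def)

lemma set_prod_basis: "set bs = Basis \<Longrightarrow> set bs' = Basis \<Longrightarrow> set (prod_basis bs bs') = Basis"
  by (simp add: prod_basis_def Basis_prod_def)

lemma stores_prod_basis:
  "stores (prod_basis bs bs') \<sigma> (x, y) \<longleftrightarrow>
     (\<forall>k<length bs. \<sigma> k = x \<bullet> (bs ! k)) \<and> (\<forall>k<length bs'. \<sigma> (length bs + k) = y \<bullet> (bs' ! k))"
    (is "?L \<longleftrightarrow> ?R")
proof
  assume L: ?L
  have "\<sigma> k = x \<bullet> (bs ! k)" if "k < length bs" for k
    using L that by (auto simp: stores_def prod_basis_def nth_append dest!: spec[of _ k])
  moreover have "\<sigma> (length bs + k) = y \<bullet> (bs' ! k)" if "k < length bs'" for k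
    using L that by (auto simp: stores_def prod_basis_def nth_append dest!: spec[of _ "length bs + k"])
  ultimately show ?R by blast
next
  assume R: ?R
  show ?L
    unfolding stores_def
  proof (intro allI impI)
    fix k assume k: "k < length (prod_basis bs bs')"
    show "\<sigma> k = (x, y) \<bullet> (prod_basis bs bs' ! k)"
    proof (cases "k < length bs")
      case True
      then show ?thesis using R by (simp add: prod_basis_def nth_append)
    next
      case False
      then obtain j where "k = length bs + j" "j < length bs'"
        using k by (auto simp: prod_basis_def dest!: le_Suc_ex leI)
      then show ?thesis using R by (simp add: prod_basis_def nth_append)
    qed
  qed
qed

lemma computable_inE:
  assumes "computable_in \<Phi> t bs bs' S f"
  obtains P where "prims P \<subseteq> \<Phi>"
    and "\<And>x \<sigma>. x \<in> S \<Longrightarrow> stores bs \<sigma> x \<Longrightarrow> steps P \<sigma> \<le> t"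
    and "\<And>x \<sigma>. x \<in> S \<Longrightarrow> stores bs \<sigma> x \<Longrightarrow> stores bs' (exec P \<sigma>) (f x)"
  using assms unfolding computable_in_def by blast

lemma computable_in_mono:
  "computable_in \<Phi> t bs bs' S f \<Longrightarrow> t \<le> t' \<Longrightarrow> computable_in \<Phi> t' bs bs' S f"
  unfolding computable_in_def by (meson order_trans)

text \<open>Array 0 receives \<open>a\<close>, entry \<open>length bs\<close> of array 1 the scaling
  \<open>a \<bullet> u\<close>, array 2 a zero, and array 3 a copy of \<open>u\<close> on which a
  subprogram may work. Copying is done by adding zero.\<close>

definition scaling_prog :: "nat \<Rightarrow> 'a::euclidean_space \<Rightarrow> 'a list \<Rightarrow> prog" where
  "scaling_prog N a bs = seq (vconst (arr N 0) (\<lambda>k. a \<bullet> (bs ! k)) (length bs))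
    (seq (vdot N 1 (arr N 0) (\<lambda>k. k) (length bs)) (Do (Const (arr N 2 0) 0)
    (varith Plus (arr N 3) (\<lambda>k. k) (\<lambda>_. arr N 2 0) (length bs))))"

lemma prims_scaling_prog [simp]: "prims (scaling_prog N a bs) \<subseteq> \<Phi>"
  by (simp add: scaling_prog_def prims_seq_subset)

lemma steps_scaling_prog [simp]: "steps (scaling_prog N a bs) \<sigma> = 4 * length bs + 2"
  by (simp add: scaling_prog_def)

lemma exec_scaling_prog:
  assumes bs: "distinct bs" "set bs = Basis" "length bs \<le> N"
    and inp: "\<And>k. k < length bs \<Longrightarrow> \<sigma> k = u \<bullet> (bs ! k)"
  shows "k < N \<Longrightarrow> exec (scaling_prog N a bs) \<sigma> k = \<sigma> k"
    and "k < length bs \<Longrightarrow> exec (scaling_prog N a bs) \<sigma> (arr N 0 k) = a \<bullet> (bs ! k)"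
    and "exec (scaling_prog N a bs) \<sigma> (arr N 1 (length bs)) = a \<bullet> u"
    and "exec (scaling_prog N a bs) \<sigma> (arr N 2 0) = 0"
    and "k < length bs \<Longrightarrow> exec (scaling_prog N a bs) \<sigma> (arr N 3 k) = u \<bullet> (bs ! k)"
  using bs(3) inp inner_basis_list[OF bs(1,2), of a u]
  by (simp_all add: scaling_prog_def exec_varith_arr exec_vdot)

section \<open>Evaluation of \<open>d\<^sub>z\<close>, its gradient and the maximizer\<close>

context scaled_dgf
begin

text \<open>One enumeration per factor serves the value, the gradient and the maximizer alike, as
  \<open>nice_dgf\<close> demands.\<close>

context
  fixes bs :: "'a list" and bs' :: "'b list"
  assumes bs: "distinct bs" "set bs = Basis" and bs': "distinct bs'" "set bs' = Basis"
begin

lemma length_bs: "length bs = DIM('a)" "length bs' = DIM('b)"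
  using bs bs' distinct_card by metis+

lemma computable_d\<^sub>z:
  assumes "computable_in \<Phi> t\<^sub>u bs [1] U d\<^sub>u" "computable_in \<Phi> t\<^sub>v bs' [1] V d\<^sub>v"
  shows "computable_in \<Phi> (t\<^sub>u + t\<^sub>v + 10 * (length bs + length bs')) (prod_basis bs bs') [1] Z d\<^sub>z"
proof -
  obtain P where P: "prims P \<subseteq> \<Phi>" "\<And>u \<sigma>. u \<in> U \<Longrightarrow> stores bs \<sigma> u \<Longrightarrow> steps P \<sigma> \<le> t\<^sub>u"
    "\<And>u \<sigma>. u \<in> U \<Longrightarrow> stores bs \<sigma> u \<Longrightarrow> stores [1] (exec P \<sigma>) (d\<^sub>u u)"
    using computable_inE[OF assms(1)] by blast
  obtain Q where Q: "prims Q \<subseteq> \<Phi>" "\<And>v \<sigma>. v \<in> V \<Longrightarrow> stores bs' \<sigma> v \<Longrightarrow> steps Q \<sigma> \<le> t\<^sub>v"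
    "\<And>v \<sigma>. v \<in> V \<Longrightarrow> stores bs' \<sigma> v \<Longrightarrow> stores [1] (exec Q \<sigma>) (d\<^sub>v v)"
    using computable_inE[OF assms(2)] by blast
  define m where "m = length bs"
  define n where "n = length bs'"
  define r where "r = arr (m + n)"
  \<comment> \<open>Dimensions are positive, so constant overheads fit into
    \<open>10 * (m + n)\<close>.\<close>
  have mn: "0 < m" "0 < n" using length_bs by (simp_all add: m_def n_def)
  define R1 where "R1 = scaling_prog (m + n) a bs"
  define R2 where "R2 = relocate (r 3) P"
  define R3 where "R3 = varith Divide (r 4) (\<lambda>k. m + k) (\<lambda>_. r 1 m) n"
  define R4 where "R4 = relocate (r 4) Q"
  define R5 where "R5 = Do (Const (r 5 0) \<alpha>) (Do (Arith Times (r 5 0) (r 5 0) (r 1 m))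
    (Do (Arith Times (r 5 0) (r 5 0) (r 4 0)) (Do (Arith Plus 0 (r 3 0) (r 5 0)) Halt)))"
  \<comment> \<open>The scaling is nonnegative on \<open>U\<close>, so the comparison with the
    stored zero tests \<open>a \<bullet> u = 0\<close>; only the other branch divides by it.\<close>
  let ?R = "seq R1 (seq R2 (IfLe (r 1 m) (r 2 0) (Do (Arith Plus 0 (r 3 0) (r 2 0)) Halt)
    (seq R3 (seq R4 R5))))"
  have "prims ?R \<subseteq> \<Phi>"
    using P(1) Q(1) by (simp add: prims_seq_subset R1_def R2_def R3_def R4_def R5_def r_def)
  moreover have "steps ?R \<sigma> \<le> t\<^sub>u + t\<^sub>v + 10 * (m + n) \<and> stores [1] (exec ?R \<sigma>) (d\<^sub>z z)"
    if z: "z \<in> Z" and \<sigma>: "stores (prod_basis bs bs') \<sigma> z" for z \<sigma>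
  proof -
    obtain u v where uv: "z = (u, (a \<bullet> u) *\<^sub>R v)" "u \<in> U" "v \<in> V" using z by (rule Z_memE)
    have inp: "\<sigma> k = u \<bullet> (bs ! k)" if "k < m" for k
      using \<sigma> that by (simp add: uv stores_prod_basis m_def)
    have inp': "\<sigma> (m + k) = (a \<bullet> u) * (v \<bullet> (bs' ! k))" if "k < n" for k
      using \<sigma> that by (simp add: uv stores_prod_basis m_def n_def)
    define \<sigma>1 where "\<sigma>1 = exec R1 \<sigma>"
    have "length bs \<le> m + n" by (simp add: m_def)
    note ex = exec_scaling_prog[OF bs this inp[unfolded m_def], where a = a,
        folded R1_def \<sigma>1_def r_def m_def]
    have s1: "\<sigma>1 (r 3 k) = u \<bullet> (bs ! k)" if "k < m" for k
      using that ex(5) by simp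
    have s1': "\<sigma>1 (m + k) = (a \<bullet> u) * (v \<bullet> (bs' ! k))" if "k < n" for k
      using that inp' ex(1) by simp
    have s1h: "\<sigma>1 (r 1 m) = a \<bullet> u" "\<sigma>1 (r 2 0) = 0"
      using ex by simp_all
    have st3: "stores bs (\<lambda>k. \<sigma>1 (r 3 k)) u" using s1 by (simp add: stores_def m_def)
    define \<sigma>2 where "\<sigma>2 = exec R2 \<sigma>1"
    have s2: "\<sigma>2 (r 3 0) = d\<^sub>u u" "\<sigma>2 (r 1 m) = a \<bullet> u" "\<sigma>2 (r 2 0) = 0"
      using P(3)[OF uv(2) st3] s1h by (simp_all add: \<sigma>2_def R2_def stores_def r_def)
    have s2': "\<sigma>2 (m + k) = (a \<bullet> u) * (v \<bullet> (bs' ! k))" if "k < n" for k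
      using that s1' by (simp add: \<sigma>2_def R2_def r_def)
    have t12: "steps R1 \<sigma> + steps R2 \<sigma>1 \<le> t\<^sub>u + 4 * m + 2"
      using P(2)[OF uv(2) st3] by (simp add: R1_def R2_def r_def m_def)
    show ?thesis
    proof (cases "a \<bullet> u = 0")
      case True
      then show ?thesis
        using t12 mn s2 by (simp add: stores_def \<sigma>1_def[symmetric] \<sigma>2_def[symmetric] uv(1)
            d\<^sub>z_def dilation_def)
    next
      case False
      then have h: "0 < a \<bullet> u" using h_nonneg[OF uv(2)] by simp
      define \<sigma>3 where "\<sigma>3 = exec R3 \<sigma>2"
      have s3: "\<sigma>3 (r 4 k) = v \<bullet> (bs' ! k)" if "k < n" for k
        using that s2' s2 h by (simp add: \<sigma>3_def R3_def r_def exec_varith_arr)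
      have s3h: "\<sigma>3 (r 3 0) = d\<^sub>u u" "\<sigma>3 (r 1 m) = a \<bullet> u"
        using s2 by (simp_all add: \<sigma>3_def R3_def r_def exec_varith_arr)
      have st4: "stores bs' (\<lambda>k. \<sigma>3 (r 4 k)) v" using s3 by (simp add: stores_def n_def)
      define \<sigma>4 where "\<sigma>4 = exec R4 \<sigma>3"
      have s4: "\<sigma>4 (r 4 0) = d\<^sub>v v" "\<sigma>4 (r 3 0) = d\<^sub>u u" "\<sigma>4 (r 1 m) = a \<bullet> u"
        using Q(3)[OF uv(3) st4] s3h by (simp_all add: \<sigma>4_def R4_def stores_def r_def)
      have "exec R5 \<sigma>4 0 = d\<^sub>z z"
        using s4 mn by (simp add: R5_def r_def uv(1) d\<^sub>z_scaled mult.assoc)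
      moreover have "steps R3 \<sigma>2 + steps R4 \<sigma>3 + steps R5 \<sigma>4 \<le> n + t\<^sub>v + 4"
        using Q(2)[OF uv(3) st4] by (simp add: R3_def R4_def R5_def r_def)
      ultimately show ?thesis
        using t12 mn s2 h by (simp add: stores_def \<sigma>1_def[symmetric] \<sigma>2_def[symmetric]
            \<sigma>3_def[symmetric] \<sigma>4_def[symmetric])
    qed
  qed
  ultimately show ?thesis unfolding computable_in_def m_def n_def by blast
qed

text \<open>On the relative interior the scaling is positive, so \<open>v\<close> is recovered by
  division without a test. The coefficient of \<open>a\<close> contains \<open>d\<^sub>v v\<close>,
  which accounts for \<open>t\<^sub>v\<close> in the time bound.\<close>

lemma computable_grad_d\<^sub>z:
  assumes grad_u: "\<forall>u\<in>rel_interior U. has_grad U d\<^sub>u u (G\<^sub>u u)"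
    and grad_v: "\<forall>v\<in>rel_interior V. has_grad V d\<^sub>v v (G\<^sub>v v)"
    and "computable_in \<Phi> s\<^sub>u bs bs (rel_interior U) G\<^sub>u"
    and "computable_in \<Phi> t\<^sub>v bs' [1] V d\<^sub>v" "computable_in \<Phi> s\<^sub>v bs' bs' (rel_interior V) G\<^sub>v"
  shows "\<exists>G. (\<forall>z\<in>rel_interior Z. has_grad Z d\<^sub>z z (G z)) \<and>
    computable_in \<Phi> (s\<^sub>u + t\<^sub>v + s\<^sub>v + 10 * (length bs + length bs'))
      (prod_basis bs bs') (prod_basis bs bs') (rel_interior Z) G"
proof -
  obtain P where P: "prims P \<subseteq> \<Phi>" "\<And>u \<sigma>. u \<in> rel_interior U \<Longrightarrow> stores bs \<sigma> u \<Longrightarrow> steps P \<sigma> \<le> s\<^sub>u"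
    "\<And>u \<sigma>. u \<in> rel_interior U \<Longrightarrow> stores bs \<sigma> u \<Longrightarrow> stores bs (exec P \<sigma>) (G\<^sub>u u)"
    using computable_inE[OF assms(3)] by blast
  obtain Q where Q: "prims Q \<subseteq> \<Phi>" "\<And>v \<sigma>. v \<in> V \<Longrightarrow> stores bs' \<sigma> v \<Longrightarrow> steps Q \<sigma> \<le> t\<^sub>v"
    "\<And>v \<sigma>. v \<in> V \<Longrightarrow> stores bs' \<sigma> v \<Longrightarrow> stores [1] (exec Q \<sigma>) (d\<^sub>v v)"
    using computable_inE[OF assms(4)] by blast
  obtain Q' where Q': "prims Q' \<subseteq> \<Phi>" "\<And>v \<sigma>. v \<in> rel_interior V \<Longrightarrow> stores bs' \<sigma> v \<Longrightarrow> steps Q' \<sigma> \<le> s\<^sub>v"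
    "\<And>v \<sigma>. v \<in> rel_interior V \<Longrightarrow> stores bs' \<sigma> v \<Longrightarrow> stores bs' (exec Q' \<sigma>) (G\<^sub>v v)"
    using computable_inE[OF assms(5)] by blast
  define G where "G = (\<lambda>z. let u = fst z; v = snd z /\<^sub>R (a \<bullet> u) in
    (G\<^sub>u u + (\<alpha> * (d\<^sub>v v - G\<^sub>v v \<bullet> v)) *\<^sub>R a, \<alpha> *\<^sub>R G\<^sub>v v))"
  have G: "G (u, (a \<bullet> u) *\<^sub>R v) = (G\<^sub>u u + (\<alpha> * (d\<^sub>v v - G\<^sub>v v \<bullet> v)) *\<^sub>R a, \<alpha> *\<^sub>R G\<^sub>v v)"
    if "0 < a \<bullet> u" for u v
    using that by (simp add: G_def)
  have "has_grad Z d\<^sub>z z (G z)" if z: "z \<in> rel_interior Z" for z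
  proof -
    obtain u v where uv: "z = (u, (a \<bullet> u) *\<^sub>R v)" "u \<in> rel_interior U" "v \<in> rel_interior V" "0 < a \<bullet> u"
      using rel_interior_ZE[OF z] by metis
    moreover have "u \<in> U" "v \<in> V" using uv rel_interior_subset by blast+
    ultimately show ?thesis using grad_u grad_v by (auto simp: G intro!: has_grad_d\<^sub>z)
  qed
  moreover
  define m where "m = length bs"
  define n where "n = length bs'"
  define r where "r = arr (m + n)"
  have mn: "0 < m" "0 < n" using length_bs by (simp_all add: m_def n_def)
  define R1 where "R1 = scaling_prog (m + n) a bs"
  define R2 where "R2 = relocate (r 3) P"
  \<comment> \<open>Three copies of \<open>v\<close> are made: arrays 4 and 5 are overwritten by the
    programs for \<open>d\<^sub>v\<close> and its gradient, and array 6 keeps \<open>v\<close> for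
    the inner product.\<close>
  define R3 where "R3 = (\<lambda>j. varith Divide (r j) (\<lambda>k. m + k) (\<lambda>_. r 1 m) n)"
  define R4 where "R4 = relocate (r 4) Q"
  define R5 where "R5 = relocate (r 5) Q'"
  \<comment> \<open>The coefficient of \<open>a\<close> ends up in \<open>r 9 0\<close>, and array
    10 receives that multiple of \<open>a\<close>.\<close>
  define R6 where "R6 = seq (vdot (m + n) 7 (r 5) (r 6) n)
    (Do (Const (r 8 0) \<alpha>) (Do (Arith Minus (r 9 0) (r 4 0) (r 7 n))
    (Do (Arith Times (r 9 0) (r 9 0) (r 8 0)) (varith Times (r 10) (r 0) (\<lambda>_. r 9 0) m))))"
  define R7 where "R7 = seq (varith Plus (\<lambda>k. k) (r 3) (r 10) m)
    (varith Times (\<lambda>k. m + k) (r 5) (\<lambda>_. r 8 0) n)"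
  let ?R = "seq R1 (seq R2 (seq (R3 4) (seq (R3 5) (seq (R3 6) (seq R4 (seq R5 (seq R6 R7)))))))"
  have "prims ?R \<subseteq> \<Phi>"
    using P(1) Q(1) Q'(1)
    by (simp add: prims_seq_subset R1_def R2_def R3_def R4_def R5_def R6_def R7_def r_def)
  moreover have "steps ?R \<sigma> \<le> s\<^sub>u + t\<^sub>v + s\<^sub>v + 10 * (m + n) \<and>
      stores (prod_basis bs bs') (exec ?R \<sigma>) (G z)"
    if z: "z \<in> rel_interior Z" and \<sigma>: "stores (prod_basis bs bs') \<sigma> z" for z \<sigma>
  proof -
    obtain u v where uv: "z = (u, (a \<bullet> u) *\<^sub>R v)" "u \<in> rel_interior U" "v \<in> rel_interior V" "0 < a \<bullet> u"
      using rel_interior_ZE[OF z] by metis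
    have vV: "v \<in> V" using uv rel_interior_subset by blast
    have inp: "\<sigma> k = u \<bullet> (bs ! k)" if "k < m" for k
      using \<sigma> that by (simp add: uv stores_prod_basis m_def)
    have inp': "\<sigma> (m + k) = (a \<bullet> u) * (v \<bullet> (bs' ! k))" if "k < n" for k
      using \<sigma> that by (simp add: uv stores_prod_basis m_def n_def)
    define \<sigma>1 where "\<sigma>1 = exec R1 \<sigma>"
    have "length bs \<le> m + n" by (simp add: m_def)
    note ex = exec_scaling_prog[OF bs this inp[unfolded m_def], where a = a,
        folded R1_def \<sigma>1_def r_def m_def]
    have st3: "stores bs (\<lambda>k. \<sigma>1 (r 3 k)) u" using ex(5) by (simp add: stores_def m_def)
    define \<sigma>2 where "\<sigma>2 = exec R2 \<sigma>1"
    have s2: "\<sigma>2 (r 0 k) = a \<bullet> (bs ! k)" "\<sigma>2 (r 3 k) = G\<^sub>u u \<bullet> (bs ! k)" if "k < m" for k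
      using P(3)[OF uv(2) st3] ex(2) that by (simp_all add: \<sigma>2_def R2_def stores_def r_def m_def)
    have s2h: "\<sigma>2 (r 1 m) = a \<bullet> u"
      using ex(3) by (simp add: \<sigma>2_def R2_def r_def)
    have s2': "\<sigma>2 (m + k) = (a \<bullet> u) * (v \<bullet> (bs' ! k))" if "k < n" for k
      using that ex(1) inp' by (simp add: \<sigma>2_def R2_def r_def)
    define \<sigma>3 where "\<sigma>3 = exec (R3 6) (exec (R3 5) (exec (R3 4) \<sigma>2))"
    have s3: "\<sigma>3 (r 0 k) = a \<bullet> (bs ! k)" "\<sigma>3 (r 3 k) = G\<^sub>u u \<bullet> (bs ! k)" if "k < m" for k
      using s2 that by (simp_all add: \<sigma>3_def R3_def r_def exec_varith_arr)
    have s3': "\<sigma>3 (r 4 k) = v \<bullet> (bs' ! k)" "\<sigma>3 (r 5 k) = v \<bullet> (bs' ! k)" "\<sigma>3 (r 6 k) = v \<bullet> (bs' ! k)"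
      if "k < n" for k
      using that s2' s2h uv(4) by (simp_all add: \<sigma>3_def R3_def r_def exec_varith_arr)
    have st4: "stores bs' (\<lambda>k. \<sigma>3 (r 4 k)) v" using s3' by (simp add: stores_def n_def)
    define \<sigma>4 where "\<sigma>4 = exec R4 \<sigma>3"
    have s4: "\<sigma>4 (r 5 k) = v \<bullet> (bs' ! k)" "\<sigma>4 (r 6 k) = v \<bullet> (bs' ! k)" if "k < n" for k
      using s3' that by (simp_all add: \<sigma>4_def R4_def r_def)
    have st5: "stores bs' (\<lambda>k. \<sigma>4 (r 5 k)) v" using s4 by (simp add: stores_def n_def)
    define \<sigma>5 where "\<sigma>5 = exec R5 \<sigma>4"
    have s5: "\<sigma>5 (r 0 k) = a \<bullet> (bs ! k)" "\<sigma>5 (r 3 k) = G\<^sub>u u \<bullet> (bs ! k)" if "k < m" for k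
      using s3 that by (simp_all add: \<sigma>5_def \<sigma>4_def R5_def R4_def r_def)
    have s5v: "\<sigma>5 (r 5 k) = G\<^sub>v v \<bullet> (bs' ! k)" "\<sigma>5 (r 6 k) = v \<bullet> (bs' ! k)" if "k < n" for k
      using Q'(3)[OF uv(3) st5] s4 that by (simp_all add: \<sigma>5_def R5_def r_def stores_def n_def)
    have s5d: "\<sigma>5 (r 4 0) = d\<^sub>v v"
      using Q(3)[OF vV st4] by (simp add: \<sigma>5_def \<sigma>4_def R5_def R4_def stores_def r_def)
    define \<sigma>6 where "\<sigma>6 = exec R6 \<sigma>5"
    have s6: "\<sigma>6 (r 3 k) = G\<^sub>u u \<bullet> (bs ! k)"
      "\<sigma>6 (r 10 k) = (a \<bullet> (bs ! k)) * ((d\<^sub>v v - G\<^sub>v v \<bullet> v) * \<alpha>)" if "k < m" for k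
      using s5 s5v s5d that inner_basis_list[OF bs', of "G\<^sub>v v" v]
      by (simp_all add: \<sigma>6_def R6_def r_def exec_varith_arr exec_vdot n_def)
    have s6v: "\<sigma>6 (r 5 k) = G\<^sub>v v \<bullet> (bs' ! k)" "\<sigma>6 (r 8 0) = \<alpha>" if "k < n" for k
      using s5v that by (simp_all add: \<sigma>6_def R6_def r_def exec_varith_arr)
    have "exec R7 \<sigma>6 k = (G\<^sub>u u + (\<alpha> * (d\<^sub>v v - G\<^sub>v v \<bullet> v)) *\<^sub>R a) \<bullet> (bs ! k)" if "k < m" for k
      using s6 that by (simp add: R7_def r_def exec_varith_input0[of _ "m + n"]
          exec_varith_input[of _ _ "m + n"] inner_add_left)
    moreover have "exec R7 \<sigma>6 (m + k) = (\<alpha> *\<^sub>R G\<^sub>v v) \<bullet> (bs' ! k)" if "k < n" for k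
      using s6v that by (simp add: R7_def r_def exec_varith_input[of _ _ "m + n"])
    ultimately have "stores (prod_basis bs bs') (exec R7 \<sigma>6) (G z)"
      by (simp add: stores_prod_basis uv(1) G[OF uv(4)] m_def n_def)
    moreover have "steps R1 \<sigma> + steps R2 \<sigma>1 + steps R4 \<sigma>3 + steps R5 \<sigma>4 \<le> 4 * m + 2 + s\<^sub>u + t\<^sub>v + s\<^sub>v"
      using P(2)[OF uv(2) st3] Q(2)[OF vV st4] Q'(2)[OF uv(3) st5]
      by (simp add: R1_def R2_def R4_def R5_def r_def m_def)
    moreover have "steps (R3 j) \<tau> = n" "steps R6 \<tau> = 2 * n + m + 4" "steps R7 \<tau> = m + n" for j \<tau>
      by (simp_all add: R3_def R6_def R7_def)
    ultimately show ?thesis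
      using mn by (simp add: \<sigma>1_def[symmetric] \<sigma>2_def[symmetric] \<sigma>3_def[symmetric]
          \<sigma>4_def[symmetric] \<sigma>5_def[symmetric] \<sigma>6_def[symmetric])
  qed
  ultimately show ?thesis unfolding computable_in_def m_def n_def by blast
qed

text \<open>On \<open>Z\<close> the objective is \<open>g\<^sub>u \<bullet> u - d\<^sub>u u + \<alpha> h(u) (g\<^sub>v / \<alpha> \<bullet> v - d\<^sub>v v)\<close>. Since \<open>h \<ge> 0\<close>, the
  maximization over \<open>v\<close> does not depend on \<open>u\<close>, and its value \<open>s / \<alpha>\<close> only shifts \<open>g\<^sub>u\<close> by \<open>s a\<close>.\<close>

lemma arg_max_d\<^sub>z:
  assumes v: "is_arg_max (\<lambda>x. (g\<^sub>v /\<^sub>R \<alpha>) \<bullet> x - d\<^sub>v x) (\<lambda>x. x \<in> V) v"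
    and s: "s = g\<^sub>v \<bullet> v - \<alpha> * d\<^sub>v v"
    and u: "is_arg_max (\<lambda>x. (g\<^sub>u + s *\<^sub>R a) \<bullet> x - d\<^sub>u x) (\<lambda>x. x \<in> U) u"
  shows "is_arg_max (\<lambda>z. (g\<^sub>u, g\<^sub>v) \<bullet> z - d\<^sub>z z) (\<lambda>z. z \<in> Z) (u, (a \<bullet> u) *\<^sub>R v)"
proof -
  have obj: "(g\<^sub>u, g\<^sub>v) \<bullet> (x, (a \<bullet> x) *\<^sub>R y) - d\<^sub>z (x, (a \<bullet> x) *\<^sub>R y) =
      g\<^sub>u \<bullet> x - d\<^sub>u x + (a \<bullet> x) * (g\<^sub>v \<bullet> y - \<alpha> * d\<^sub>v y)" for x y
    by (simp add: d\<^sub>z_scaled algebra_simps)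
  have uv: "u \<in> U" "v \<in> V" using u v by (auto simp: is_arg_max_def)
  have le_s: "g\<^sub>v \<bullet> y - \<alpha> * d\<^sub>v y \<le> s" if "y \<in> V" for y
  proof -
    have "(g\<^sub>v /\<^sub>R \<alpha>) \<bullet> y - d\<^sub>v y \<le> (g\<^sub>v /\<^sub>R \<alpha>) \<bullet> v - d\<^sub>v v"
      using v that by (auto simp: is_arg_max_def not_less)
    then have "\<alpha> * ((g\<^sub>v /\<^sub>R \<alpha>) \<bullet> y - d\<^sub>v y) \<le> \<alpha> * ((g\<^sub>v /\<^sub>R \<alpha>) \<bullet> v - d\<^sub>v v)"
      using \<alpha>_pos by (intro mult_left_mono) auto
    then show ?thesis using \<alpha>_pos by (simp add: s right_diff_distrib flip: mult.assoc)
  qed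
  have "(g\<^sub>u, g\<^sub>v) \<bullet> z - d\<^sub>z z \<le> (g\<^sub>u, g\<^sub>v) \<bullet> (u, (a \<bullet> u) *\<^sub>R v) - d\<^sub>z (u, (a \<bullet> u) *\<^sub>R v)"
    if z: "z \<in> Z" for z
  proof -
    obtain x y where xy: "z = (x, (a \<bullet> x) *\<^sub>R y)" "x \<in> U" "y \<in> V" using z by (rule Z_memE)
    have "(a \<bullet> x) * (g\<^sub>v \<bullet> y - \<alpha> * d\<^sub>v y) \<le> (a \<bullet> x) * s"
      using xy h_nonneg le_s by (intro mult_left_mono) auto
    moreover have "(g\<^sub>u + s *\<^sub>R a) \<bullet> x - d\<^sub>u x \<le> (g\<^sub>u + s *\<^sub>R a) \<bullet> u - d\<^sub>u u"
      using u xy(2) by (auto simp: is_arg_max_def not_less)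
    ultimately show ?thesis
      unfolding xy(1) obj s[symmetric] by (simp add: inner_add_left mult.commute)
  qed
  then show ?thesis
    using uv by (auto simp: is_arg_max_def not_less Z_memI)
qed

text \<open>The stages run in sequence, each program once: \<open>v\<close> from the scaled
  \<open>g\<^sub>v\<close>, then its optimal value \<open>s\<close>, then \<open>u\<close> from the
  shifted \<open>g\<^sub>u\<close>. Subprograms leave the input registers intact, so both parts of
  the input stay available.\<close>

lemma computable_arg_max_d\<^sub>z:
  assumes max_u: "\<forall>g. is_arg_max (\<lambda>x. g \<bullet> x - d\<^sub>u x) (\<lambda>x. x \<in> U) (A\<^sub>u g)"
    and max_v: "\<forall>g. is_arg_max (\<lambda>x. g \<bullet> x - d\<^sub>v x) (\<lambda>x. x \<in> V) (A\<^sub>v g)"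
    and "computable_in \<Phi> s\<^sub>u bs bs UNIV A\<^sub>u"
    and "computable_in \<Phi> t\<^sub>v bs' [1] V d\<^sub>v" "computable_in \<Phi> s\<^sub>v bs' bs' UNIV A\<^sub>v"
  shows "\<exists>A. (\<forall>g. is_arg_max (\<lambda>x. g \<bullet> x - d\<^sub>z x) (\<lambda>x. x \<in> Z) (A g)) \<and>
    computable_in \<Phi> (s\<^sub>u + t\<^sub>v + s\<^sub>v + 10 * (length bs + length bs'))
      (prod_basis bs bs') (prod_basis bs bs') UNIV A"
proof -
  obtain P where P: "prims P \<subseteq> \<Phi>" "\<And>u \<sigma>. u \<in> UNIV \<Longrightarrow> stores bs \<sigma> u \<Longrightarrow> steps P \<sigma> \<le> s\<^sub>u"
    "\<And>u \<sigma>. u \<in> UNIV \<Longrightarrow> stores bs \<sigma> u \<Longrightarrow> stores bs (exec P \<sigma>) (A\<^sub>u u)"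
    using computable_inE[OF assms(3)] by blast
  obtain Q where Q: "prims Q \<subseteq> \<Phi>" "\<And>v \<sigma>. v \<in> V \<Longrightarrow> stores bs' \<sigma> v \<Longrightarrow> steps Q \<sigma> \<le> t\<^sub>v"
    "\<And>v \<sigma>. v \<in> V \<Longrightarrow> stores bs' \<sigma> v \<Longrightarrow> stores [1] (exec Q \<sigma>) (d\<^sub>v v)"
    using computable_inE[OF assms(4)] by blast
  obtain Q' where Q': "prims Q' \<subseteq> \<Phi>" "\<And>v \<sigma>. v \<in> UNIV \<Longrightarrow> stores bs' \<sigma> v \<Longrightarrow> steps Q' \<sigma> \<le> s\<^sub>v"
    "\<And>v \<sigma>. v \<in> UNIV \<Longrightarrow> stores bs' \<sigma> v \<Longrightarrow> stores bs' (exec Q' \<sigma>) (A\<^sub>v v)"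
    using computable_inE[OF assms(5)] by blast
  define v where "v = (\<lambda>g :: 'a \<times> 'b. A\<^sub>v (snd g /\<^sub>R \<alpha>))"
  define s where "s = (\<lambda>g. snd g \<bullet> v g - \<alpha> * d\<^sub>v (v g))"
  define u where "u = (\<lambda>g. A\<^sub>u (fst g + s g *\<^sub>R a))"
  define A where "A = (\<lambda>g. (u g, (a \<bullet> u g) *\<^sub>R v g))"
  have "is_arg_max (\<lambda>x. g \<bullet> x - d\<^sub>z x) (\<lambda>x. x \<in> Z) (A g)" for g
  proof -
    have "is_arg_max (\<lambda>x. (snd g /\<^sub>R \<alpha>) \<bullet> x - d\<^sub>v x) (\<lambda>x. x \<in> V) (v g)"
      unfolding v_def by (rule max_v[rule_format])
    moreover have "is_arg_max (\<lambda>x. (fst g + s g *\<^sub>R a) \<bullet> x - d\<^sub>u x) (\<lambda>x. x \<in> U) (u g)"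
      unfolding u_def by (rule max_u[rule_format])
    ultimately show ?thesis
      using arg_max_d\<^sub>z[of "snd g" "v g" "s g" "fst g" "u g"] by (simp add: s_def A_def)
  qed
  moreover
  define m where "m = length bs"
  define n where "n = length bs'"
  define r where "r = arr (m + n)"
  have mn: "0 < m" "0 < n" using length_bs by (simp_all add: m_def n_def)
  define R1 where "R1 = Do (Const (r 0 0) \<alpha>) (Do (Const (r 0 1) 0)
    (varith Divide (r 1) (\<lambda>k. m + k) (\<lambda>_. r 0 0) n))"
  define R2 where "R2 = relocate (r 1) Q'"
  \<comment> \<open>The maximizer \<open>v\<close> is duplicated: array 2 is consumed in evaluating
    \<open>d\<^sub>v\<close>, while array 1 is kept for \<open>s\<close> and the output.\<close>
  define R3 where "R3 = varith Plus (r 2) (r 1) (\<lambda>_. r 0 1) n"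
  define R4 where "R4 = relocate (r 2) Q"
  \<comment> \<open>The value \<open>s\<close> is formed in \<open>r 4 0\<close>, and array 7
    receives \<open>g\<^sub>u + s *\<^sub>R a\<close>, the input of \<open>P\<close>.\<close>
  define R5 where "R5 = seq (vdot (m + n) 3 (\<lambda>k. m + k) (r 1) n)
    (Do (Arith Times (r 4 0) (r 2 0) (r 0 0)) (Do (Arith Minus (r 4 0) (r 3 n) (r 4 0))
    (seq (vconst (r 5) (\<lambda>k. a \<bullet> (bs ! k)) m) (seq (varith Times (r 6) (r 5) (\<lambda>_. r 4 0) m)
    (varith Plus (r 7) (\<lambda>k. k) (r 6) m)))))"
  define R6 where "R6 = relocate (r 7) P"
  \<comment> \<open>Array 7 now holds \<open>u\<close>; its inner product with \<open>a\<close> is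
    the scaling by which \<open>v\<close> is multiplied in the output.\<close>
  define R7 where "R7 = seq (vdot (m + n) 8 (r 5) (r 7) m)
    (seq (varith Plus (\<lambda>k. k) (r 7) (\<lambda>_. r 0 1) m) (varith Times (\<lambda>k. m + k) (r 1) (\<lambda>_. r 8 m) n))"
  let ?R = "seq R1 (seq R2 (seq R3 (seq R4 (seq R5 (seq R6 R7)))))"
  have "prims ?R \<subseteq> \<Phi>"
    using P(1) Q(1) Q'(1)
    by (simp add: prims_seq_subset R1_def R2_def R3_def R4_def R5_def R6_def R7_def r_def)
  moreover have "steps ?R \<sigma> \<le> s\<^sub>u + t\<^sub>v + s\<^sub>v + 10 * (m + n) \<and>
      stores (prod_basis bs bs') (exec ?R \<sigma>) (A g)"
    if \<sigma>: "stores (prod_basis bs bs') \<sigma> g" for g \<sigma>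
  proof -
    have inp: "\<sigma> k = fst g \<bullet> (bs ! k)" if "k < m" for k
      using \<sigma> that by (cases g) (simp add: stores_prod_basis m_def)
    have inp': "\<sigma> (m + k) = snd g \<bullet> (bs' ! k)" if "k < n" for k
      using \<sigma> that by (cases g) (simp add: stores_prod_basis m_def n_def)
    define \<sigma>1 where "\<sigma>1 = exec R1 \<sigma>"
    have s1: "\<sigma>1 (r 1 k) = (snd g /\<^sub>R \<alpha>) \<bullet> (bs' ! k)" if "k < n" for k
      using that inp' by (simp add: \<sigma>1_def R1_def r_def exec_varith_arr divide_inverse mult.commute)
    have s1c: "\<sigma>1 (r 0 0) = \<alpha>" "\<sigma>1 (r 0 1) = 0"
      by (simp_all add: \<sigma>1_def R1_def r_def exec_varith_arr)
    have s1i: "\<sigma>1 k = \<sigma> k" if "k < m + n" for k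
      using that by (simp add: \<sigma>1_def R1_def r_def)
    have st1: "stores bs' (\<lambda>k. \<sigma>1 (r 1 k)) (snd g /\<^sub>R \<alpha>)" using s1 by (simp add: stores_def n_def)
    define \<sigma>3 where "\<sigma>3 = exec R3 (exec R2 \<sigma>1)"
    have s3: "\<sigma>3 (r 1 k) = v g \<bullet> (bs' ! k)" "\<sigma>3 (r 2 k) = v g \<bullet> (bs' ! k)" if "k < n" for k
      using Q'(3)[OF UNIV_I st1] s1c that
      by (simp_all add: \<sigma>3_def R2_def R3_def r_def exec_varith_arr stores_def v_def n_def)
    have s3c: "\<sigma>3 (r 0 0) = \<alpha>" "\<sigma>3 (r 0 1) = 0"
      using s1c by (simp_all add: \<sigma>3_def R3_def R2_def r_def exec_varith_arr)
    have s3i: "\<sigma>3 k = \<sigma> k" if "k < m + n" for k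
      using that s1i by (simp add: \<sigma>3_def R3_def R2_def r_def)
    have st3: "stores bs' (\<lambda>k. \<sigma>3 (r 2 k)) (v g)" using s3 by (simp add: stores_def n_def)
    have vV: "v g \<in> V" using max_v by (simp add: v_def is_arg_max_def)
    define \<sigma>4 where "\<sigma>4 = exec R4 \<sigma>3"
    have s4: "\<sigma>4 (r 2 0) = d\<^sub>v (v g)" "\<sigma>4 (r 0 0) = \<alpha>" "\<sigma>4 (r 0 1) = 0"
      using Q(3)[OF vV st3] s3c by (simp_all add: \<sigma>4_def R4_def stores_def r_def)
    have s4v: "\<sigma>4 (r 1 k) = v g \<bullet> (bs' ! k)" if "k < n" for k
      using s3 that by (simp add: \<sigma>4_def R4_def r_def)
    have s4i: "\<sigma>4 k = \<sigma> k" if "k < m + n" for k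
      using that s3i by (simp add: \<sigma>4_def R4_def r_def)
    define \<sigma>5 where "\<sigma>5 = exec R5 \<sigma>4"
    have s5: "\<sigma>5 (r 5 k) = a \<bullet> (bs ! k)" "\<sigma>5 (r 7 k) = (fst g + s g *\<^sub>R a) \<bullet> (bs ! k)" if "k < m" for k
      using that s4 s4v s4i inp inp' inner_basis_list[OF bs', of "snd g" "v g"]
      by (simp_all add: \<sigma>5_def R5_def r_def exec_varith_arr exec_vdot s_def n_def
          inner_add_left mult.commute)
    have s5v: "\<sigma>5 (r 1 k) = v g \<bullet> (bs' ! k)" "\<sigma>5 (r 0 1) = 0" if "k < n" for k
      using s4 s4v that by (simp_all add: \<sigma>5_def R5_def r_def exec_varith_arr)
    have st5: "stores bs (\<lambda>k. \<sigma>5 (r 7 k)) (fst g + s g *\<^sub>R a)" using s5 by (simp add: stores_def m_def)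
    define \<sigma>6 where "\<sigma>6 = exec R6 \<sigma>5"
    have s6: "\<sigma>6 (r 5 k) = a \<bullet> (bs ! k)" "\<sigma>6 (r 7 k) = u g \<bullet> (bs ! k)" if "k < m" for k
      using P(3)[OF UNIV_I st5] s5 that by (simp_all add: \<sigma>6_def R6_def r_def u_def stores_def m_def)
    have s6v: "\<sigma>6 (r 1 k) = v g \<bullet> (bs' ! k)" "\<sigma>6 (r 0 1) = 0" if "k < n" for k
      using s5v that by (simp_all add: \<sigma>6_def R6_def r_def)
    have "exec R7 \<sigma>6 k = u g \<bullet> (bs ! k)" if "k < m" for k
      using s6 s6v(2)[OF mn(2)] that by (simp add: R7_def r_def exec_varith_input0[of _ "m + n"]
          exec_varith_input[of _ _ "m + n"])
    moreover have "exec R7 \<sigma>6 (m + k) = ((a \<bullet> u g) *\<^sub>R v g) \<bullet> (bs' ! k)" if "k < n" for k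
      using s6 s6v that inner_basis_list[OF bs, of a "u g"]
      by (simp add: R7_def r_def exec_varith_input[of _ _ "m + n"] exec_vdot m_def)
    ultimately have "stores (prod_basis bs bs') (exec R7 \<sigma>6) (A g)"
      by (simp add: stores_prod_basis A_def m_def n_def)
    moreover have "steps R2 \<sigma>1 + steps R4 \<sigma>3 + steps R6 \<sigma>5 \<le> s\<^sub>u + t\<^sub>v + s\<^sub>v"
      using P(2)[OF UNIV_I st5] Q(2)[OF vV st3] Q'(2)[OF UNIV_I st1]
      by (simp add: R2_def R4_def R6_def r_def)
    moreover have "steps R1 \<tau> = n + 2" "steps R3 \<tau> = n" "steps R5 \<tau> = 2 * n + 3 * m + 3"
      "steps R7 \<tau> = 3 * m + n + 1" for \<tau>
      by (simp_all add: R1_def R3_def R5_def R7_def)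
    ultimately show ?thesis
      using mn by (simp add: \<sigma>1_def[symmetric] \<sigma>3_def[symmetric]
          \<sigma>4_def[symmetric] \<sigma>5_def[symmetric] \<sigma>6_def[symmetric])
  qed
  ultimately show ?thesis unfolding computable_in_def m_def n_def by blast
qed

end

text \<open>The new constant depends on \<open>c\<^sub>u\<close> and \<open>c\<^sub>v\<close> alone
  and not on the dimensions, so linear time is preserved uniformly over families.\<close>

theorem nice_dgf_d\<^sub>z:
  assumes "nice_dgf \<Phi> c\<^sub>u U d\<^sub>u" "nice_dgf \<Phi> c\<^sub>v V d\<^sub>v"
  shows "nice_dgf \<Phi> (100 * (c\<^sub>u + c\<^sub>v + 1)) Z d\<^sub>z"
proof -
  obtain bs G\<^sub>u A\<^sub>u where bs: "distinct bs" "set bs = Basis"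
    and u: "computable_in \<Phi> (c\<^sub>u * DIM('a)) bs [1] U d\<^sub>u"
      "\<forall>x\<in>rel_interior U. has_grad U d\<^sub>u x (G\<^sub>u x)"
      "computable_in \<Phi> (c\<^sub>u * DIM('a)) bs bs (rel_interior U) G\<^sub>u"
      "\<forall>g. is_arg_max (\<lambda>x. g \<bullet> x - d\<^sub>u x) (\<lambda>x. x \<in> U) (A\<^sub>u g)"
      "computable_in \<Phi> (c\<^sub>u * DIM('a)) bs bs UNIV A\<^sub>u"
    using assms(1) unfolding nice_dgf_def by blast
  obtain bs' G\<^sub>v A\<^sub>v where bs': "distinct bs'" "set bs' = Basis"
    and v: "computable_in \<Phi> (c\<^sub>v * DIM('b)) bs' [1] V d\<^sub>v"
      "\<forall>x\<in>rel_interior V. has_grad V d\<^sub>v x (G\<^sub>v x)"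
      "computable_in \<Phi> (c\<^sub>v * DIM('b)) bs' bs' (rel_interior V) G\<^sub>v"
      "\<forall>g. is_arg_max (\<lambda>x. g \<bullet> x - d\<^sub>v x) (\<lambda>x. x \<in> V) (A\<^sub>v g)"
      "computable_in \<Phi> (c\<^sub>v * DIM('b)) bs' bs' UNIV A\<^sub>v"
    using assms(2) unfolding nice_dgf_def by blast
  let ?t = "100 * (c\<^sub>u + c\<^sub>v + 1) * DIM('a \<times> 'b)"
  \<comment> \<open>The costliest tasks make one call for \<open>U\<close> and two for
    \<open>V\<close>. Each dimension is at most their sum, which is the dimension of the product, so
    the factor 100 is ample.\<close>
  have "c\<^sub>u * DIM('a) + 2 * (c\<^sub>v * DIM('b)) + 10 * (DIM('a) + DIM('b)) \<le> ?t"
    by (simp add: algebra_simps)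
  then have t: "c\<^sub>u * DIM('a) + c\<^sub>v * DIM('b) + 10 * (length bs + length bs') \<le> ?t"
    "c\<^sub>u * DIM('a) + c\<^sub>v * DIM('b) + c\<^sub>v * DIM('b) + 10 * (length bs + length bs') \<le> ?t"
    by (simp_all only: length_bs[OF bs bs'])
  have "\<exists>G. (\<forall>z\<in>rel_interior Z. has_grad Z d\<^sub>z z (G z)) \<and>
      computable_in \<Phi> ?t (prod_basis bs bs') (prod_basis bs bs') (rel_interior Z) G"
    using computable_grad_d\<^sub>z[OF bs bs' u(2) v(2) u(3) v(1,3)] computable_in_mono[OF _ t(2)] by blast
  moreover have "\<exists>A. (\<forall>g. is_arg_max (\<lambda>x. g \<bullet> x - d\<^sub>z x) (\<lambda>x. x \<in> Z) (A g)) \<and>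
      computable_in \<Phi> ?t (prod_basis bs bs') (prod_basis bs bs') UNIV A"
    using computable_arg_max_d\<^sub>z[OF bs bs' u(4) v(4) u(5) v(1,5)] computable_in_mono[OF _ t(2)] by blast
  moreover have "computable_in \<Phi> ?t (prod_basis bs bs') [1] Z d\<^sub>z"
    using computable_d\<^sub>z[OF bs bs' u(1) v(1)] computable_in_mono[OF _ t(1)] by blast
  ultimately show ?thesis
    unfolding nice_dgf_def
    using is_dgf_d\<^sub>z distinct_prod_basis[OF bs bs'(1)] set_prod_basis[OF bs(2) bs'(2)] by blast
qed

end

theorem proposition1:
  fixes U :: "(real ^ 'm) set" and V :: "(real ^ 'n) set"
    and a :: "real ^ 'm" and h :: "real ^ 'm \<Rightarrow> real"
    and Z :: "((real ^ 'm) \<times> (real ^ 'n)) set"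
    and d\<^sub>u \<nu>\<^sub>u :: "real ^ 'm \<Rightarrow> real" and d\<^sub>v \<nu>\<^sub>v :: "real ^ 'n \<Rightarrow> real"
    and d\<^sub>z :: "(real ^ 'm) \<times> (real ^ 'n) \<Rightarrow> real"
    and \<alpha>\<^sub>v :: real
  assumes "U \<noteq> {}" "compact U" "convex U"
    and "V \<noteq> {}" "compact V" "convex V"
    and h_linear: "h = (\<lambda>u. a \<bullet> u)"
    and h_nonneg: "\<forall>u\<in>U. h u \<ge> 0"
    and h_pos: "\<forall>u\<in>rel_interior U. h u > 0"
    and Z_eq: "Z = scaled_extension h U V"
    and "is_norm \<nu>\<^sub>u" "dgf_wrt \<nu>\<^sub>u U d\<^sub>u"
    and "is_norm \<nu>\<^sub>v" "dgf_wrt \<nu>\<^sub>v V d\<^sub>v"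
    and "\<alpha>\<^sub>v > 0"
    and d\<^sub>z_eq: "d\<^sub>z = (\<lambda>(u, w). d\<^sub>u u + \<alpha>\<^sub>v * dilation h d\<^sub>v (u, w))"
  shows "is_dgf Z d\<^sub>z \<and>
    (\<forall>\<Phi> c\<^sub>u c\<^sub>v. nice_dgf \<Phi> c\<^sub>u U d\<^sub>u \<and> nice_dgf \<Phi> c\<^sub>v V d\<^sub>v \<longrightarrow>
       nice_dgf \<Phi> (100 * (c\<^sub>u + c\<^sub>v + 1)) Z d\<^sub>z)"
proof -
  interpret S: scaled_dgf U V a d\<^sub>u \<nu>\<^sub>u d\<^sub>v \<nu>\<^sub>v \<alpha>\<^sub>v
    by (unfold_locales; (fact | use h_nonneg h_pos h_linear in blast))
  have "Z = S.Z" by (simp add: Z_eq h_linear S.Z_def)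
  moreover have "d\<^sub>z = S.d\<^sub>z" by (simp add: d\<^sub>z_eq h_linear S.d\<^sub>z_def)
  ultimately show ?thesis by (auto simp only: intro: S.is_dgf_d\<^sub>z S.nice_dgf_d\<^sub>z)
qed

end
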